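(* Let $\varphi,\psi\colon\mathbb{D}\to\mathbb{D}$ be analytic and let $\alpha\in\mathbb{T}$. Put \[Z=\{\zeta\in\mathbb{T}:\ 0<\tau_{\varphi,\alpha}(\{\zeta\})\neq\tau_{\psi,\alpha}(\{\zeta\})\}.\] Then $\|C_\varphi-C_\psi\|_e^2\ \ge\ \tau_{\varphi,\alpha}(Z)$, where $\|\cdot\|_e$ is the essential norm of an operator on $\mathcal{H}^2$.
   Context: $\mathbb{D}$ is the open unit disc, $\mathbb{T}=\partial\mathbb{D}$, $m$ normalized Lebesgue measure on $\mathbb{T}$, $P_z(\zeta)=(1-|z|^2)/|\zeta-z|^2$. For analytic $\varphi\colon\mathbb{D}\to\mathbb{D}$ and $\alpha\in\mathbb{T}$, the Aleksandrov–Clark measure $\tau_{\varphi,\alpha}$ is the unique positive Borel measure on $\mathbb{T}$ with $\operatorname{Re}\frac{\alpha+\varphi(z)}{\alpha-\varphi(z)}=\frac{1-|\varphi(z)|^2}{|\alpha-\varphi(z)|^2}=\int_{\mathbb{T}}P_z\,d\tau_{\varphi,\alpha}$ for $z\in\mathbb{D}$. $C_\varphi f=f\circ\varphi$ on the Hardy space $\mathcal{H}^2$; the essential norm $\|T\|_e$ is the distance in operator norm from $T$ to the compact operators on $\mathcal{H}^2$. *)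

theory Defs
  imports "HOL-Analysis.Analysis"
begin

definition analytic_selfmap :: "(complex \<Rightarrow> complex) \<Rightarrow> bool" where
  "analytic_selfmap \<phi> \<longleftrightarrow> \<phi> holomorphic_on ball 0 1 \<and> \<phi> ` ball 0 1 \<subseteq> ball 0 1"

definition int_mean2 :: "(complex \<Rightarrow> complex) \<Rightarrow> real \<Rightarrow> real" where
  "int_mean2 f r = (1 / (2 * pi)) * integral {0..2*pi} (\<lambda>t. (cmod (f (of_real r * cis t)))\<^sup>2)"

definition H2 :: "(complex \<Rightarrow> complex) set" where
  "H2 = {f. f holomorphic_on ball 0 1 \<and> bdd_above (int_mean2 f ` {0..<1})}"

definition h2_norm :: "(complex \<Rightarrow> complex) \<Rightarrow> real" where
  "h2_norm f = sqrt (SUP r\<in>{0..<1}. int_mean2 f r)"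

type_synonym h2op = "(complex \<Rightarrow> complex) \<Rightarrow> (complex \<Rightarrow> complex)"

definition comp_op :: "(complex \<Rightarrow> complex) \<Rightarrow> h2op" where
  "comp_op \<phi> f = f \<circ> \<phi>"

definition op_norm :: "h2op \<Rightarrow> real" where
  "op_norm T = (SUP f\<in>{f\<in>H2. h2_norm f \<le> 1}. h2_norm (T f))"

text \<open>Compact (linear) operators on H^2: linear maps of H^2 into H^2 such that the image
  of every bounded sequence has an H^2-Cauchy (hence, by completeness, convergent) subsequence.\<close>
definition compact_op :: "h2op \<Rightarrow> bool" where
  "compact_op K \<longleftrightarrow>
     (\<forall>f\<in>H2. K f \<in> H2) \<and>
     (\<forall>f\<in>H2. \<forall>g\<in>H2. \<forall>a b::complex. \<forall>z\<in>ball 0 1.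
         K (\<lambda>w. a * f w + b * g w) z = a * K f z + b * K g z) \<and>
     (\<forall>F::nat \<Rightarrow> (complex \<Rightarrow> complex). (\<forall>n. F n \<in> H2 \<and> h2_norm (F n) \<le> 1) \<longrightarrow>
        (\<exists>r::nat \<Rightarrow> nat. strict_mono r \<and>
           (\<forall>e::real>0. \<exists>N::nat. \<forall>m\<ge>N. \<forall>n\<ge>N.
               h2_norm (\<lambda>z. K (F (r m)) z - K (F (r n)) z) < e)))"

definition ess_norm :: "h2op \<Rightarrow> real" where
  "ess_norm T = (INF C\<in>{C. compact_op C}. op_norm (\<lambda>f z. T f z - C f z))"

definition poisson :: "complex \<Rightarrow> complex \<Rightarrow> real" where
  "poisson z \<zeta> = (1 - (cmod z)\<^sup>2) / (cmod (\<zeta> - z))\<^sup>2"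

definition clark_measure :: "(complex \<Rightarrow> complex) \<Rightarrow> complex \<Rightarrow> complex measure" where
  "clark_measure \<phi> \<alpha> = (THE \<mu>. sets \<mu> = sets (restrict_space borel (sphere 0 1)) \<and>
      space \<mu> = sphere 0 1 \<and> finite_measure \<mu> \<and>
      (\<forall>z\<in>ball 0 1. Re ((\<alpha> + \<phi> z) / (\<alpha> - \<phi> z)) = (\<integral>\<zeta>. poisson z \<zeta> \<partial>\<mu>)))"

end

theory Submission
  imports Defs "HOL-Complex_Analysis.Conformal_Mappings" "HOL-Probability.Helly_Selection"
begin

text \<open>
  An atom of mass \<^term>\<open>a\<close> of the Clark measure of \<^term>\<open>\<phi>\<close> at \<^term>\<open>\<zeta>\<close> is read off nontangentially from the Herglotz
  representation: \<^term>\<open>\<epsilon> / (1 - cnj \<alpha> * \<phi> z)\<close> tends to \<^term>\<open>a / s\<close> for \<^term>\<open>z = \<zeta> * (1 - \<epsilon> * s)\<close>.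
  Given finitely many atoms of masses \<^term>\<open>a\<close> at points \<^term>\<open>\<zeta>\<close> of \<^term>\<open>Z\<close> with total mass \<^term>\<open>A\<close>, test the
  operator on the normalised reproducing kernel at \<^term>\<open>w = \<alpha> * (1 - \<epsilon> * s)\<close>, where \<^term>\<open>s = 1 + \<i> * M\<close>, and
  pair the result with the combination, with weights \<^term>\<open>sqrt (a / A)\<close>, of the normalised kernels at
  \<^term>\<open>\<zeta> * (1 - \<epsilon> * a * s)\<close>. These are asymptotically orthonormal and weakly null, so a compact perturbation does
  not matter in the limit. The contribution of \<^term>\<open>\<phi>\<close> tends to \<^term>\<open>sqrt A\<close>. That of \<^term>\<open>\<psi>\<close>, with atoms
  of masses \<^term>\<open>b\<close> different from \<^term>\<open>a\<close>, is controlled by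
  \<^term>\<open>b / (a * s + b * cnj s)\<close>, which vanishes as \<^term>\<open>M\<close> tends to infinity.
\<close>

section \<open>The Hardy space in terms of Taylor coefficients\<close>

text \<open>Scaling by the mass a makes the points \<open>\<zeta> * (1 - \<epsilon> * a * s)\<close>
  collide: by the atom limit, \<phi> maps each of them to w up to o(\<epsilon>), so one test kernel
  sees every atom at full strength, each contributing \<open>sqrt a\<close>. The weights
  \<open>sqrt (a / A)\<close> form the unit vector that maximises the weighted sum of these
  contributions, by Cauchy--Schwarz. Where \<psi> has an atom of mass b > 0, it sends the point
  close to \<open>\<alpha> * (1 - \<epsilon> * (a / b) * s)\<close> instead. For real s this stays
  at bounded hyperbolic distance from w, so a radial approach leaves a definite overlap; along a
  steep ray two points with different scale factors drift arbitrarily far apart, hence the parameter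
  M. Two conventions force much of the remaining work: \<open>clark_measure\<close> is a definite
  description and calls for existence and uniqueness, and \<open>op_norm\<close> is a supremum of
  reals, which dominates its members only once composition operators and compact operators are known
  to be bounded.\<close>

definition disc_series :: "(nat \<Rightarrow> complex) \<Rightarrow> (complex \<Rightarrow> complex) \<Rightarrow> bool" where
  "disc_series a f \<longleftrightarrow> (\<forall>z\<in>ball 0 1. (\<lambda>n. a n * z ^ n) sums f z)"

lemma holomorphic_imp_disc_series:
  assumes "f holomorphic_on ball 0 1"
  obtains a where "disc_series a f"
proof
  show "disc_series (\<lambda>n. (deriv ^^ n) f 0 / fact n) f"
    using holomorphic_power_series[OF assms] by (simp add: disc_series_def)
qed

lemma disc_series_imp_holomorphic:
  assumes "disc_series a f"
  shows "f holomorphic_on ball 0 1"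
  using power_series_holomorphic[of 0 1 a f] assms by (simp add: disc_series_def)

lemma disc_series_norm_summable:
  assumes "disc_series a f" "0 \<le> r" "r < 1"
  shows "summable (\<lambda>n. cmod (a n) * r ^ n)"
proof -
  \<comment> \<open>Any modulus strictly between r and 1 serves: convergence there forces absolute
    convergence at r.\<close>
  define x :: complex where "x = of_real ((1 + r) / 2)"
  have "x \<in> ball 0 1" "norm (of_real r :: complex) < norm x"
    using assms by (auto simp: x_def simp del: of_real_add of_real_divide)
  then have "summable (\<lambda>n. norm (a n * of_real r ^ n))"
    using assms(1) powser_insidea[of a x "of_real r"] unfolding disc_series_def
    by (auto simp: sums_iff)
  then show ?thesis
    using assms by (simp add: norm_mult norm_power)
qed

lemma norm_mult_less_1:
  fixes x y :: complex
  assumes "cmod x < 1" "cmod y < 1"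
  shows "cmod (x * y) < 1"
  using assms mult_strict_mono[of "cmod x" 1 "cmod y" 1] by (simp add: norm_mult)

section \<open>Parseval's identity on circles and the coefficient form of the norm\<close>

lemma has_integral_cis_mult_cnj:
  "((\<lambda>t. cis (real m * t) * cnj (cis (real n * t))) has_integral (if m = n then of_real (2 * pi) else 0)) {0..2*pi}"
proof (cases "m = n")
  case True
  have "((\<lambda>t::real. 1::complex) has_integral of_real (2 * pi)) {0..2*pi}"
    using has_integral_const_real[of "1::complex" 0 "2*pi"] by (simp add: scaleR_conv_of_real)
  then show ?thesis
    using True by (simp add: cis_mult cis_cnj)
next
  case False
  define k :: real where "k = real m - real n"
  have k: "k \<noteq> 0" "k \<in> \<int>"
    using False by (auto simp: k_def)
  have deriv: "((\<lambda>t. cis (k * t) / (\<i> * k)) has_vector_derivative cis (k * t)) (at t within {0..2*pi})" for t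
  proof -
    have "((\<lambda>u. exp (\<i> * k * u) / (\<i> * k)) has_field_derivative exp (\<i> * k * of_real t)) (at (of_real t))"
      using k by (auto intro!: derivative_eq_intros)
    from has_vector_derivative_real_field[OF this] show ?thesis
      by (simp add: cis_conv_exp mult.assoc)
  qed
  have "((\<lambda>t. cis (k * t)) has_integral (cis (k * (2*pi)) / (\<i> * k) - cis (k * 0) / (\<i> * k))) {0..2*pi}"
    by (rule fundamental_theorem_of_calculus) (auto intro: deriv)
  moreover have "cis (k * (2*pi)) = 1"
    using k(2) by (metis cis_multiple_2pi mult.assoc mult.commute)
  ultimately show ?thesis
    using False by (simp add: k_def cis_mult cis_cnj algebra_simps)
qed

lemma parseval_polynomial:
  "((\<lambda>t. (cmod (\<Sum>n<N. b n * cis (real n * t)))\<^sup>2) has_integral 2 * pi * (\<Sum>n<N. (cmod (b n))\<^sup>2)) {0..2*pi}"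
proof -
  have "((\<lambda>t. \<Sum>m<N. \<Sum>n<N. (b m * cnj (b n)) * (cis (real m * t) * cnj (cis (real n * t))))
     has_integral (\<Sum>m<N. \<Sum>n<N. (b m * cnj (b n)) * (if m = n then of_real (2 * pi) else 0))) {0..2*pi}"
    by (intro has_integral_sum has_integral_mult_right has_integral_cis_mult_cnj) auto
  moreover have "(\<Sum>m<N. \<Sum>n<N. (b m * cnj (b n)) * (if m = n then of_real (2 * pi) else 0))
      = complex_of_real (2 * pi * (\<Sum>n<N. (cmod (b n))\<^sup>2))"
    by (simp add: if_distrib[of "(*) _"] sum.delta sum_distrib_left complex_norm_square[symmetric] mult.commute
          del: of_real_power cong: if_cong)
  moreover have "(\<Sum>m<N. \<Sum>n<N. (b m * cnj (b n)) * (cis (real m * t) * cnj (cis (real n * t))))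
      = complex_of_real ((cmod (\<Sum>n<N. b n * cis (real n * t)))\<^sup>2)" for t
    unfolding complex_norm_square cnj_sum sum_product by (simp add: algebra_simps)
  ultimately have "((\<lambda>t. complex_of_real ((cmod (\<Sum>n<N. b n * cis (real n * t)))\<^sup>2)) has_integral
      complex_of_real (2 * pi * (\<Sum>n<N. (cmod (b n))\<^sup>2))) {0..2*pi}"
    by (simp only:)
  from has_integral_linear[OF this bounded_linear_Re] show ?thesis
    by (simp only: o_def Re_complex_of_real)
qed

text \<open>Parseval for the partial sums passes to the limit by dominated convergence, since on a
  circle of radius r < 1 all partial sums are bounded by the sum of
  \<open>cmod (a n) * r ^ n\<close>.\<close>

lemma disc_series_parseval:
  assumes "disc_series a f" "r \<in> {0..<1}"
  shows "(\<lambda>n. (cmod (a n))\<^sup>2 * r ^ (2 * n)) sums int_mean2 f r"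
proof -
  define b where "b n = a n * of_real r ^ n" for n
  define B where "B = (\<Sum>n. cmod (b n))"
  have summ: "summable (\<lambda>n. cmod (b n))"
    using disc_series_norm_summable[OF assms(1), of r] assms(2) by (simp add: b_def norm_mult norm_power)
  have lim: "(\<lambda>N. \<Sum>n<N. b n * cis (real n * t)) \<longlonglongrightarrow> f (of_real r * cis t)" for t
  proof -
    have "of_real r * cis t \<in> ball 0 1"
      using assms(2) by (simp add: norm_mult)
    then have "(\<lambda>n. a n * (of_real r * cis t) ^ n) sums f (of_real r * cis t)"
      using assms(1) by (simp add: disc_series_def)
    then show ?thesis
      by (simp add: sums_def b_def power_mult_distrib Complex.DeMoivre mult.assoc)
  qed
  have bound: "cmod (\<Sum>n<N. b n * cis (real n * t)) \<le> B" for N t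
  proof -
    have "cmod (\<Sum>n<N. b n * cis (real n * t)) \<le> (\<Sum>n<N. cmod (b n))"
      by (rule order_trans[OF norm_sum]) (simp add: norm_mult)
    also have "\<dots> \<le> B"
      unfolding B_def by (rule sum_le_suminf[OF summ]) auto
    finally show ?thesis .
  qed
  have "(\<lambda>N. integral {0..2*pi} (\<lambda>t. (cmod (\<Sum>n<N. b n * cis (real n * t)))\<^sup>2))
      \<longlonglongrightarrow> integral {0..2*pi} (\<lambda>t. (cmod (f (of_real r * cis t)))\<^sup>2)"
  proof (rule dominated_convergence(2)[where h = "\<lambda>_. B\<^sup>2"])
    show "(\<lambda>t. (cmod (\<Sum>n<N. b n * cis (real n * t)))\<^sup>2) integrable_on {0..2*pi}" for N
      using parseval_polynomial by blast
    show "norm ((cmod (\<Sum>n<N. b n * cis (real n * t)))\<^sup>2) \<le> B\<^sup>2" for N t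
      using bound[where N=N and t=t] by (simp add: power_mono)
    show "(\<lambda>N. (cmod (\<Sum>n<N. b n * cis (real n * t)))\<^sup>2) \<longlonglongrightarrow> (cmod (f (of_real r * cis t)))\<^sup>2" for t
      by (intro tendsto_intros lim)
  qed auto
  then have "(\<lambda>N. 1 / (2 * pi) * (2 * pi * (\<Sum>n<N. (cmod (b n))\<^sup>2))) \<longlonglongrightarrow> int_mean2 f r"
    unfolding int_mean2_def using parseval_polynomial[THEN integral_unique] by (intro tendsto_mult) auto
  moreover have "(cmod (b n))\<^sup>2 = (cmod (a n))\<^sup>2 * r ^ (2 * n)" for n
    using assms(2) by (simp add: b_def norm_mult norm_power power_mult_distrib power_mult[symmetric] mult.commute)
  ultimately show ?thesis
    by (simp add: sums_def)
qed

text \<open>This turns the supremum over radii in \<open>H2\<close> and \<open>h2_norm\<close> into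
  a sum of squared Taylor coefficients. A finite partial sum is the limit of its own Abel means as r
  tends to 1, so it is at most any bound of \<open>I\<close>; conversely the factor
  \<open>r ^ (2 * n)\<close> only shrinks each term.\<close>

lemma abel_means_SUP:
  fixes c :: "nat \<Rightarrow> real"
  assumes nonneg: "\<And>n. 0 \<le> c n"
    and I: "\<And>r. r \<in> {0..<1} \<Longrightarrow> (\<lambda>n. c n * r ^ (2 * n)) sums I r"
  shows "bdd_above (I ` {0..<1}) \<longleftrightarrow> summable c"
    and "summable c \<Longrightarrow> (SUP r\<in>{0..<1}. I r) = suminf c"
proof -
  have partial: "sum c {..<N} \<le> B" if B: "\<And>r. r \<in> {0..<1} \<Longrightarrow> I r \<le> B" for B N
  proof (rule tendsto_upperbound)
    have "((\<lambda>r. \<Sum>n<N. c n * r ^ (2 * n)) \<longlongrightarrow> (\<Sum>n<N. c n * 1 ^ (2 * n))) (at_left 1)"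
      by (intro tendsto_intros)
    then show "((\<lambda>r. \<Sum>n<N. c n * r ^ (2 * n)) \<longlongrightarrow> sum c {..<N}) (at_left 1)"
      by simp
    have "\<forall>\<^sub>F r :: real in at_left 1. r \<in> {0<..<1}"
      by (rule eventually_at_leftI[of 0]) auto
    then show "\<forall>\<^sub>F r in at_left 1. (\<Sum>n<N. c n * r ^ (2 * n)) \<le> B"
    proof eventually_elim
      case (elim r)
      then have s: "(\<lambda>n. c n * r ^ (2 * n)) sums I r"
        by (intro I) auto
      have "(\<Sum>n<N. c n * r ^ (2 * n)) \<le> (\<Sum>n. c n * r ^ (2 * n))"
        using s elim nonneg by (intro sum_le_suminf) (auto simp: sums_iff)
      also have "\<dots> = I r"
        using s by (simp add: sums_iff)
      also have "\<dots> \<le> B"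
        using elim by (intro B) auto
      finally show ?case .
    qed
  qed auto
  have le: "I r \<le> suminf c" if "summable c" "r \<in> {0..<1}" for r
  proof -
    have "c n * r ^ (2 * n) \<le> c n" for n
      using that(2) nonneg[of n] by (intro mult_left_le power_le_one) auto
    then show ?thesis
      using suminf_le[of "\<lambda>n. c n * r ^ (2 * n)" c] I[OF that(2)] that(1) by (auto simp: sums_iff)
  qed
  show "bdd_above (I ` {0..<1}) \<longleftrightarrow> summable c"
  proof
    assume "bdd_above (I ` {0..<1})"
    then obtain B where "\<And>r. r \<in> {0..<1} \<Longrightarrow> I r \<le> B"
      unfolding bdd_above_def by blast
    then show "summable c"
      using partial nonneg by (intro summableI_nonneg_bounded[of c B]) auto
  next
    assume "summable c"
    then show "bdd_above (I ` {0..<1})"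
      using le by (intro bdd_aboveI2) auto
  qed
  assume c: "summable c"
  have "suminf c \<le> (SUP r\<in>{0..<1}. I r)"
  proof (rule suminf_le_const[OF c partial])
    fix r :: real assume "r \<in> {0..<1}"
    then show "I r \<le> (SUP r\<in>{0..<1}. I r)"
      using le[OF c] by (intro cSUP_upper bdd_aboveI2[of _ _ "suminf c"]) auto
  qed
  moreover have "(SUP r\<in>{0..<1}. I r) \<le> suminf c"
    using le[OF c] by (intro cSUP_least) auto
  ultimately show "(SUP r\<in>{0..<1}. I r) = suminf c"
    by simp
qed

lemma H2_iff_summable:
  assumes "disc_series a f"
  shows "f \<in> H2 \<longleftrightarrow> summable (\<lambda>n. (cmod (a n))\<^sup>2)"
proof -
  have "bdd_above (int_mean2 f ` {0..<1}) \<longleftrightarrow> summable (\<lambda>n. (cmod (a n))\<^sup>2)"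
    by (rule abel_means_SUP(1)) (simp_all only: disc_series_parseval[OF assms] zero_le_power2)
  then show ?thesis
    using disc_series_imp_holomorphic[OF assms] by (simp only: H2_def mem_Collect_eq simp_thms)
qed

lemma h2_norm_sums:
  assumes "disc_series a f" "f \<in> H2"
  shows "(\<lambda>n. (cmod (a n))\<^sup>2) sums (h2_norm f)\<^sup>2" and "0 \<le> h2_norm f"
proof -
  have s: "summable (\<lambda>n. (cmod (a n))\<^sup>2)"
    using H2_iff_summable assms by blast
  have *: "h2_norm f = sqrt (\<Sum>n. (cmod (a n))\<^sup>2)"
    unfolding h2_norm_def
    by (subst abel_means_SUP(2)[OF _ disc_series_parseval[OF assms(1)] s]) auto
  have "0 \<le> (\<Sum>n. (cmod (a n))\<^sup>2)"
    by (rule suminf_nonneg[OF s]) simp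
  then show "(\<lambda>n. (cmod (a n))\<^sup>2) sums (h2_norm f)\<^sup>2" "0 \<le> h2_norm f"
    using * s by (auto simp: sums_iff)
qed

lemma H2_obtain_series:
  assumes "f \<in> H2"
  obtains a where "disc_series a f"
  using assms holomorphic_imp_disc_series[of f] by (auto simp: H2_def)

lemma h2_norm_nonneg: "f \<in> H2 \<Longrightarrow> 0 \<le> h2_norm f"
  by (rule H2_obtain_series) (auto intro: h2_norm_sums(2))

lemma L2_set_coeff_le_h2_norm:
  assumes "disc_series a f" "f \<in> H2"
  shows "L2_set (\<lambda>n. cmod (a n)) {..<N} \<le> h2_norm f"
proof -
  have "(\<Sum>n<N. (cmod (a n))\<^sup>2) \<le> (h2_norm f)\<^sup>2"
    using sum_le_suminf[of "\<lambda>n. (cmod (a n))\<^sup>2" "{..<N}"] h2_norm_sums(1)[OF assms] by (auto simp: sums_iff)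
  then show ?thesis
    unfolding L2_set_def using h2_norm_sums(2)[OF assms] by (simp add: real_le_lsqrt sum_nonneg)
qed

text \<open>Because finite sections of the coefficients suffice, the triangle inequality for
  \<open>L2_set\<close> carries over directly to the Hardy space.\<close>

lemma H2_I_L2_set:
  assumes "disc_series a f" and le: "\<And>N. L2_set (\<lambda>n. cmod (a n)) {..<N} \<le> C"
  shows "f \<in> H2" "h2_norm f \<le> C"
proof -
  have "0 \<le> C"
    using le[of 0] by simp
  have p: "(\<Sum>n<N. (cmod (a n))\<^sup>2) \<le> C\<^sup>2" for N
    using le[of N] unfolding L2_set_def by (meson sqrt_le_D)
  have "summable (\<lambda>n. (cmod (a n))\<^sup>2)"
    using p by (intro summableI_nonneg_bounded[of _ "C\<^sup>2"]) auto
  then show *: "f \<in> H2"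
    using H2_iff_summable assms(1) by blast
  have "(h2_norm f)\<^sup>2 \<le> C\<^sup>2"
    using suminf_le_const[of "\<lambda>n. (cmod (a n))\<^sup>2" "C\<^sup>2"] p h2_norm_sums(1)[OF assms(1) *] by (auto simp: sums_iff)
  then show "h2_norm f \<le> C"
    using \<open>0 \<le> C\<close> power2_le_imp_le by blast
qed

lemma H2_diff:
  assumes "f \<in> H2" "g \<in> H2"
  shows "(\<lambda>z. f z - g z) \<in> H2" "h2_norm (\<lambda>z. f z - g z) \<le> h2_norm f + h2_norm g"
proof -
  obtain a b where ab: "disc_series a f" "disc_series b g"
    using assms H2_obtain_series by metis
  then have s: "disc_series (\<lambda>n. a n - b n) (\<lambda>z. f z - g z)"
    unfolding disc_series_def by (auto intro: sums_diff simp: left_diff_distrib)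
  have "L2_set (\<lambda>n. cmod (a n - b n)) {..<N} \<le> h2_norm f + h2_norm g" for N
  proof -
    have "L2_set (\<lambda>n. cmod (a n - b n)) {..<N} \<le> L2_set (\<lambda>n. cmod (a n) + cmod (b n)) {..<N}"
      by (intro L2_set_mono) (auto intro: norm_triangle_ineq4)
    also have "\<dots> \<le> L2_set (\<lambda>n. cmod (a n)) {..<N} + L2_set (\<lambda>n. cmod (b n)) {..<N}"
      by (rule L2_set_triangle_ineq)
    also have "\<dots> \<le> h2_norm f + h2_norm g"
      by (intro add_mono L2_set_coeff_le_h2_norm ab assms)
    finally show ?thesis .
  qed
  from H2_I_L2_set[OF s this] show "(\<lambda>z. f z - g z) \<in> H2" "h2_norm (\<lambda>z. f z - g z) \<le> h2_norm f + h2_norm g"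
    by auto
qed

lemma H2_zero: "(\<lambda>_. 0) \<in> H2" "h2_norm (\<lambda>_. 0) = 0"
proof -
  have "disc_series (\<lambda>_. 0) (\<lambda>_. 0)"
    by (simp add: disc_series_def)
  from H2_I_L2_set[OF this, of 0] show "(\<lambda>_. 0) \<in> H2" "h2_norm (\<lambda>_. 0) = 0"
    using h2_norm_nonneg[of "\<lambda>_. 0"] by (auto simp: L2_set_def)
qed

text \<open>Cauchy--Schwarz against the combination of reproducing kernels that represents the functional;
  the square root is the norm of that combination.\<close>
lemma H2_evaluation_bound:
  assumes f: "f \<in> H2" and J: "finite J" and z: "\<And>j. j \<in> J \<Longrightarrow> z j \<in> ball 0 1"
  shows "cmod (\<Sum>j\<in>J. d j * f (z j)) \<le>
    h2_norm f * sqrt (Re (\<Sum>i\<in>J. \<Sum>j\<in>J. d i * cnj (d j) / (1 - z i * cnj (z j))))"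
proof -
  obtain a where a: "disc_series a f"
    using f H2_obtain_series by blast
  \<comment> \<open>The numbers \<open>cnj (e n)\<close> are the Taylor coefficients of the
    combination of Szego kernels at the points \<open>z j\<close> with weights
    \<open>cnj (d j)\<close>. Summing geometric series identifies their square sum with the Gram sum
    \<open>?G\<close>.\<close>
  define e where "e n = (\<Sum>j\<in>J. d j * z j ^ n)" for n
  let ?G = "\<Sum>i\<in>J. \<Sum>j\<in>J. d i * cnj (d j) / (1 - z i * cnj (z j))"
  have lim: "(\<lambda>N. \<Sum>n<N. a n * e n) \<longlonglongrightarrow> (\<Sum>j\<in>J. d j * f (z j))"
  proof -
    have "(\<lambda>n. \<Sum>j\<in>J. d j * (a n * z j ^ n)) sums (\<Sum>j\<in>J. d j * f (z j))"
      using a z by (intro sums_sum sums_mult) (auto simp: disc_series_def)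
    then show ?thesis
      by (simp add: sums_def e_def sum_distrib_left algebra_simps)
  qed
  have "(\<lambda>n. \<Sum>i\<in>J. \<Sum>j\<in>J. (d i * cnj (d j)) * (z i * cnj (z j)) ^ n) sums
      (\<Sum>i\<in>J. \<Sum>j\<in>J. (d i * cnj (d j)) * (1 / (1 - z i * cnj (z j))))"
  proof (intro sums_sum sums_mult geometric_sums)
    fix i j assume "i \<in> J" "j \<in> J"
    then have "cmod (z i) < 1" "cmod (z j) < 1"
      using z by auto
    then show "cmod (z i * cnj (z j)) < 1"
      using norm_mult_less_1[of "z i" "cnj (z j)"] by simp
  qed
  moreover have "(\<Sum>i\<in>J. \<Sum>j\<in>J. (d i * cnj (d j)) * (z i * cnj (z j)) ^ n) = complex_of_real ((cmod (e n))\<^sup>2)" for n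
    unfolding complex_norm_square e_def cnj_sum sum_product
    by (simp add: power_mult_distrib algebra_simps)
  ultimately have "(\<lambda>n. complex_of_real ((cmod (e n))\<^sup>2)) sums ?G"
    by simp
  then have G: "(\<lambda>n. (cmod (e n))\<^sup>2) sums Re ?G"
    using sums_Re by fastforce
  have "cmod (\<Sum>n<N. a n * e n) \<le> h2_norm f * sqrt (Re ?G)" for N
  proof -
    have "cmod (\<Sum>n<N. a n * e n) \<le> (\<Sum>n<N. \<bar>cmod (a n)\<bar> * \<bar>cmod (e n)\<bar>)"
      by (rule order_trans[OF norm_sum]) (simp add: norm_mult)
    also have "\<dots> \<le> L2_set (\<lambda>n. cmod (a n)) {..<N} * L2_set (\<lambda>n. cmod (e n)) {..<N}"
      by (rule L2_set_mult_ineq)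
    also have "\<dots> \<le> h2_norm f * sqrt (Re ?G)"
    proof (intro mult_mono L2_set_coeff_le_h2_norm a f h2_norm_nonneg)
      show "L2_set (\<lambda>n. cmod (e n)) {..<N} \<le> sqrt (Re ?G)"
        unfolding L2_set_def
        using sum_le_suminf[of "\<lambda>n. (cmod (e n))\<^sup>2" "{..<N}"] G by (auto simp: sums_iff)
    qed simp
    finally show ?thesis .
  qed
  then show ?thesis
    by (intro tendsto_upperbound[OF tendsto_norm[OF lim]]) auto
qed

section \<open>Point evaluations and normalised reproducing kernels\<close>

lemma H2_pointwise_bound:
  assumes "f \<in> H2" "z \<in> ball 0 1"
  shows "sqrt (1 - (cmod z)\<^sup>2) * cmod (f z) \<le> h2_norm f"
proof -
  have "cmod z < 1"
    using assms by simp
  then have p: "0 < 1 - (cmod z)\<^sup>2"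
    by (simp add: abs_square_less_1)
  have "1 / (1 - z * cnj z) = complex_of_real (1 / (1 - (cmod z)\<^sup>2))"
    by (simp add: complex_norm_square del: of_real_power)
  then have "cmod (f z) \<le> h2_norm f * sqrt (1 / (1 - (cmod z)\<^sup>2))"
    using H2_evaluation_bound[OF assms(1), of "{()}" "\<lambda>_. z" "\<lambda>_. 1"] assms(2)
    by (simp del: of_real_divide of_real_diff of_real_power)
  then show ?thesis
    using p by (simp add: real_sqrt_divide field_simps)
qed

text \<open>This is the weak convergence to 0 of normalised kernels whose base points tend to the
  circle. f is split into a Taylor polynomial, which is bounded on the disc and killed by the
  vanishing factor, and a tail of small norm, handled by the pointwise bound.\<close>

lemma H2_boundary_decay:
  assumes f: "f \<in> H2" and z: "\<And>n. z n \<in> ball 0 1" and lim: "(\<lambda>n. cmod (z n)) \<longlonglongrightarrow> 1"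
  shows "(\<lambda>n. of_real (sqrt (1 - (cmod (z n))\<^sup>2)) * f (z n)) \<longlonglongrightarrow> 0"
proof (rule LIMSEQ_I)
  fix e :: real assume e: "0 < e"
  obtain a where a: "disc_series a f"
    using f H2_obtain_series by blast
  have summ: "summable (\<lambda>n. (cmod (a n))\<^sup>2)"
    using H2_iff_summable a f by blast
  obtain N where N: "norm (\<Sum>k. (cmod (a (k + N)))\<^sup>2) < (e / 2)\<^sup>2"
    using suminf_exist_split[OF _ summ, of "(e/2)\<^sup>2"] e by auto
  define b where "b n = (if n < N then 0 else a n)" for n
  define p where "p w = (\<Sum>n<N. a n * w ^ n)" for w
  have b: "disc_series b (\<lambda>w. f w - p w)"
    unfolding disc_series_def
  proof
    fix w :: complex assume w: "w \<in> ball 0 1"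
    have "(\<lambda>n. if n \<in> {..<N} then a n * w ^ n else 0) sums p w"
      unfolding p_def by (rule sums_If_finite_set) simp
    from sums_diff[OF a[unfolded disc_series_def, rule_format, OF w] this]
    show "(\<lambda>n. b n * w ^ n) sums (f w - p w)"
      by (rule sums_cong[THEN iffD1, rotated]) (simp add: b_def)
  qed
  have tail: "(\<lambda>n. (cmod (b n))\<^sup>2) sums (\<Sum>k. (cmod (a (k + N)))\<^sup>2)"
  proof -
    have "(\<lambda>k. (cmod (a (k + N)))\<^sup>2) sums (\<Sum>k. (cmod (a (k + N)))\<^sup>2)"
      using summable_iff_shift[of "\<lambda>n. (cmod (a n))\<^sup>2" N] summ by (simp add: summable_sums)
    then have "(\<lambda>k. (cmod (b (k + N)))\<^sup>2) sums (\<Sum>k. (cmod (a (k + N)))\<^sup>2)"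
      by (simp add: b_def)
    then show ?thesis
      by (subst (asm) sums_iff_shift) (simp add: b_def)
  qed
  have bH: "(\<lambda>w. f w - p w) \<in> H2"
    using H2_iff_summable[OF b] tail by (simp add: sums_iff)
  have "(h2_norm (\<lambda>w. f w - p w))\<^sup>2 < (e / 2)\<^sup>2"
    using h2_norm_sums(1)[OF b bH] tail N sums_unique2 by fastforce
  then have small: "h2_norm (\<lambda>w. f w - p w) < e / 2"
    using e power_less_imp_less_base by fastforce
  define C where "C = (\<Sum>n<N. cmod (a n))"
  have p: "cmod (p w) \<le> C" if "w \<in> ball 0 1" for w
    unfolding p_def C_def
    using that by (intro order_trans[OF norm_sum] sum_mono) (auto simp: norm_mult norm_power intro!: mult_left_le power_le_one)
  have "(\<lambda>n. sqrt (1 - (cmod (z n))\<^sup>2) * C) \<longlonglongrightarrow> sqrt (1 - 1\<^sup>2) * C"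
    by (intro tendsto_intros lim)
  then have "\<forall>\<^sub>F n in sequentially. sqrt (1 - (cmod (z n))\<^sup>2) * C < e / 2"
    using e by (intro order_tendstoD(2)) auto
  then obtain n0 where n0: "\<And>n. n \<ge> n0 \<Longrightarrow> sqrt (1 - (cmod (z n))\<^sup>2) * C < e / 2"
    unfolding eventually_sequentially by blast
  show "\<exists>no. \<forall>n\<ge>no. norm (of_real (sqrt (1 - (cmod (z n))\<^sup>2)) * f (z n) - 0) < e"
  proof (intro exI[of _ n0] allI impI)
    fix n assume n: "n \<ge> n0"
    let ?s = "sqrt (1 - (cmod (z n))\<^sup>2)"
    have "cmod (z n) \<le> 1"
      using z[of n] by simp
    then have s: "0 \<le> ?s"
      by (simp add: abs_square_le_1)
    have "?s * cmod (f (z n)) \<le> ?s * cmod (f (z n) - p (z n)) + ?s * cmod (p (z n))"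
      using s by (simp add: distrib_left[symmetric] mult_left_mono norm_triangle_sub add.commute)
    also have "?s * cmod (f (z n) - p (z n)) < e / 2"
      using H2_pointwise_bound[OF bH z[of n]] small by simp
    also have "?s * cmod (p (z n)) \<le> ?s * C"
      using s p[OF z] by (rule mult_left_mono[rotated])
    also have "?s * C < e / 2"
      using n0 n by blast
    finally show "norm (of_real ?s * f (z n) - 0) < e"
      using s by (simp add: norm_mult)
  qed
qed

text \<open>The Szego kernel at w divided by its norm.\<close>

definition h2_kernel :: "complex \<Rightarrow> complex \<Rightarrow> complex" where
  "h2_kernel w z = of_real (sqrt (1 - (cmod w)\<^sup>2)) / (1 - cnj w * z)"

lemma h2_kernel_H2:
  assumes "w \<in> ball 0 1"
  shows "h2_kernel w \<in> H2" "h2_norm (h2_kernel w) \<le> 1"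
proof -
  have w: "cmod w < 1"
    using assms by simp
  then have q: "(cmod w)\<^sup>2 < 1"
    by (simp add: abs_square_less_1)
  define a where "a n = of_real (sqrt (1 - (cmod w)\<^sup>2)) * cnj w ^ n" for n
  have "disc_series a (h2_kernel w)"
    unfolding disc_series_def
  proof
    fix z :: complex assume "z \<in> ball 0 1"
    then have "cmod (cnj w * z) < 1"
      using w norm_mult_less_1[of "cnj w" z] by simp
    from sums_mult[OF geometric_sums[OF this], of "of_real (sqrt (1 - (cmod w)\<^sup>2))"]
    show "(\<lambda>n. a n * z ^ n) sums h2_kernel w z"
      by (simp add: a_def h2_kernel_def power_mult_distrib mult.assoc)
  qed
  moreover have "L2_set (\<lambda>n. cmod (a n)) {..<N} \<le> 1" for N
  proof -
    have "(\<Sum>n<N. (cmod (a n))\<^sup>2) = (1 - (cmod w)\<^sup>2) * (\<Sum>n<N. ((cmod w)\<^sup>2) ^ n)"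
      using q by (simp add: a_def norm_mult norm_power power_mult_distrib sum_distrib_left
          power_mult[symmetric] mult.commute)
    also have "\<dots> = 1 - ((cmod w)\<^sup>2) ^ N"
      by (rule one_diff_power_eq[symmetric])
    also have "\<dots> \<le> 1"
      by simp
    finally show ?thesis
      by (simp add: L2_set_def)
  qed
  ultimately show "h2_kernel w \<in> H2" "h2_norm (h2_kernel w) \<le> 1"
    by (rule H2_I_L2_set)+
qed

section \<open>Poisson formula and Littlewood subordination\<close>

text \<open>A nonconstant f would be open and take the value \<open>f 0\<close> shifted by a small
  real number, whose real part is not 0. The lemma serves to compare functions that share their real
  part, such as two Herglotz integrals.\<close>

lemma holomorphic_Re_zero_constant:
  assumes f: "f holomorphic_on ball 0 1" and Re: "\<And>z. z \<in> ball 0 1 \<Longrightarrow> Re (f z) = 0"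
    and z: "z \<in> ball 0 1"
  shows "f z = f 0"
proof (rule ccontr)
  assume ne: "f z \<noteq> f 0"
  have "\<not> f constant_on ball 0 1"
    using ne z unfolding constant_on_def by (metis centre_in_ball zero_less_one)
  then have "open (f ` ball 0 1)"
    using open_mapping_thm[OF f open_ball connected_ball open_ball subset_refl] by blast
  then obtain e where e: "e > 0" "ball (f 0) e \<subseteq> f ` ball 0 1"
    unfolding open_contains_ball by (metis centre_in_ball imageI zero_less_one)
  have "f 0 + of_real (e / 2) \<in> ball (f 0) e"
    using e(1) by (simp add: dist_norm del: of_real_divide)
  then obtain u where "u \<in> ball 0 1" "f u = f 0 + of_real (e / 2)"
    using e(2) by (metis imageE subsetD)
  then have "Re (f 0 + of_real (e / 2)) = 0"
    using Re by metis
  then show False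
    using Re[of 0] e(1) by simp
qed

lemma poisson_eq_Re:
  assumes "cmod \<zeta> = 1" "z \<in> ball 0 1"
  shows "poisson z \<zeta> = Re ((\<zeta> + z) / (\<zeta> - z))"
proof -
  have "(Re \<zeta>)\<^sup>2 + (Im \<zeta>)\<^sup>2 = 1"
    using assms(1) by (metis cmod_power2 one_power2)
  then show ?thesis
    unfolding poisson_def cmod_power2 Re_divide
    by (simp add: diff_divide_distrib[symmetric] add_divide_distrib[symmetric])
       (simp add: algebra_simps power2_eq_square)
qed

lemma poisson_bounds:
  assumes "cmod \<zeta> = 1" "z \<in> ball 0 1"
  shows "0 \<le> poisson z \<zeta>" "poisson z \<zeta> \<le> (1 + cmod z) / (1 - cmod z)"
proof -
  have z: "cmod z < 1"
    using assms by simp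
  have d: "1 - cmod z \<le> cmod (\<zeta> - z)"
    using norm_triangle_ineq2[of \<zeta> z] assms(1) by simp
  have n: "1 - (cmod z)\<^sup>2 = (1 + cmod z) * (1 - cmod z)"
    by (simp add: power2_eq_square algebra_simps)
  then have n0: "0 \<le> 1 - (cmod z)\<^sup>2"
    using z by simp
  then show "0 \<le> poisson z \<zeta>"
    by (simp add: poisson_def)
  have "poisson z \<zeta> \<le> (1 - (cmod z)\<^sup>2) / (1 - cmod z)\<^sup>2"
    unfolding poisson_def using z d n0 by (intro divide_left_mono power_mono mult_pos_pos zero_less_power) auto
  also have "\<dots> = (1 + cmod z) / (1 - cmod z)"
    using z unfolding n by (simp add: power2_eq_square)
  finally show "poisson z \<zeta> \<le> (1 + cmod z) / (1 - cmod z)" .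
qed

lemma poisson_0: "cmod \<zeta> = 1 \<Longrightarrow> poisson 0 \<zeta> = 1"
  by (simp add: poisson_def)

text \<open>Cauchy's formula applied to \<^term>\<open>\<lambda>u. g u / (1 - cnj w * u)\<close>.\<close>
lemma poisson_formula:
  assumes g: "g holomorphic_on ball 0 \<rho>" "1 < \<rho>" and w: "w \<in> ball 0 1"
  shows "((\<lambda>t. of_real (poisson w (cis t)) * g (cis t)) has_integral of_real (2 * pi) * g w) {0..2*pi}"
proof -
  define h where "h u = g u / (1 - cnj w * u)" for u
  have w1: "cmod w < 1"
    using w by simp
  have nz: "1 - cnj w * u \<noteq> 0" if "cmod u \<le> 1" for u
  proof
    assume "1 - cnj w * u = 0"
    then have "cmod (cnj w * u) = 1"
      by (metis eq_iff_diff_eq_0 norm_one)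
    moreover have "cmod w * cmod u \<le> cmod w * 1"
      using that by (intro mult_left_mono) auto
    ultimately show False
      using w1 by (simp add: norm_mult)
  qed
  have "h holomorphic_on cball 0 1"
    unfolding h_def using nz g(2)
    by (intro holomorphic_intros holomorphic_on_subset[OF g(1)]) (auto simp: cball_subset_ball_iff)
  from Cauchy_integral_circlepath_simple[OF this, of w] w
  have "((\<lambda>u. h u / (u - w)) has_contour_integral 2 * of_real pi * \<i> * h w) (circlepath 0 1)"
    by simp
  then have "((\<lambda>t. h (0 + of_real 1 * cis t) / (0 + of_real 1 * cis t - w) * of_real 1 * \<i> * cis t)
      has_integral 2 * of_real pi * \<i> * h w) {0..2*pi}"
    unfolding circlepath_def by (subst (asm) has_contour_integral_part_circlepath_iff) auto
  from has_integral_mult_right[OF this, of "of_real (1 - (cmod w)\<^sup>2) / \<i>"]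
  have "((\<lambda>t. of_real (1 - (cmod w)\<^sup>2) * (h (cis t) / (cis t - w) * cis t)) has_integral
      of_real (1 - (cmod w)\<^sup>2) * (2 * of_real pi * h w)) {0..2*pi}"
    by (simp add: mult_ac del: of_real_diff of_real_power)
  moreover have "of_real (1 - (cmod w)\<^sup>2) * (2 * of_real pi * h w) = of_real (2 * pi) * g w"
  proof -
    have "of_real (1 - (cmod w)\<^sup>2) = 1 - cnj w * w"
      by (simp add: complex_norm_square mult.commute del: of_real_power)
    then show ?thesis
      using nz[of w] w1 by (simp add: h_def)
  qed
  moreover have "of_real (1 - (cmod w)\<^sup>2) * (h (cis t) / (cis t - w) * cis t) =
      of_real (poisson w (cis t)) * g (cis t)" for t
  proof -
    have ne: "cis t - w \<noteq> 0"
      using w1 by (metis eq_iff_diff_eq_0 less_irrefl norm_cis)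
    \<comment> \<open>On the circle \<open>1 - cnj w * cis t\<close> is \<open>cis t\<close> times
      the conjugate of \<open>cis t - w\<close>, so the auxiliary denominator of \<open>h\<close>
      completes the Cauchy kernel to the squared modulus in the Poisson kernel.\<close>
    have "cis t * cnj (cis t - w) = 1 - cnj w * cis t"
      by (simp add: algebra_simps cis_cnj cis_mult)
    then have "1 / (1 - cnj w * cis t) / (cis t - w) * cis t = cis t / (cis t * cnj (cis t - w) * (cis t - w))"
      by simp
    also have "\<dots> = 1 / ((cis t - w) * cnj (cis t - w))"
      by simp
    also have "\<dots> = 1 / of_real ((cmod (cis t - w))\<^sup>2)"
      by (simp only: complex_norm_square)
    finally have "1 / (1 - cnj w * cis t) / (cis t - w) * cis t = 1 / of_real ((cmod (cis t - w))\<^sup>2)" .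
    moreover have "of_real (1 - (cmod w)\<^sup>2) * (h (cis t) / (cis t - w) * cis t) =
      of_real (1 - (cmod w)\<^sup>2) * g (cis t) * (1 / (1 - cnj w * cis t) / (cis t - w) * cis t)"
      by (simp add: h_def)
    ultimately show ?thesis
      by (simp add: poisson_def)
  qed
  ultimately show ?thesis
    by (simp only:)
qed

lemma poisson_formula_Re:
  assumes "g holomorphic_on ball 0 \<rho>" "1 < \<rho>" "w \<in> ball 0 1"
  shows "((\<lambda>t. poisson w (cis t) * Re (g (cis t))) has_integral 2 * pi * Re (g w)) {0..2*pi}"
  using has_integral_linear[OF poisson_formula[OF assms] bounded_linear_Re] by (simp add: o_def)

text \<open>A variance argument: the Poisson average of the squared modulus of
  \<open>g (cis t) - g w\<close> is nonnegative, and after expanding the square the Poisson formula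
  evaluates the cross term and the constant term.\<close>

lemma poisson_subharmonic:
  assumes g: "g holomorphic_on ball 0 \<rho>" "1 < \<rho>" and w: "w \<in> ball 0 1"
  shows "2 * pi * (cmod (g w))\<^sup>2 \<le> integral {0..2*pi} (\<lambda>t. poisson w (cis t) * (cmod (g (cis t)))\<^sup>2)"
proof -
  have cont: "continuous_on UNIV (\<lambda>t. g (cis t))"
    using g by (intro continuous_on_compose2[OF holomorphic_on_imp_continuous_on[OF g(1)]] continuous_intros) auto
  have ne: "cis t \<noteq> w" for t
    using w by auto
  have cP: "continuous_on UNIV (\<lambda>t. poisson w (cis t))"
    unfolding poisson_def using ne by (intro continuous_intros) auto
  have i1: "((\<lambda>t. poisson w (cis t) * (cmod (g (cis t)))\<^sup>2) has_integral
      integral {0..2*pi} (\<lambda>t. poisson w (cis t) * (cmod (g (cis t)))\<^sup>2)) {0..2*pi}" (is "(_ has_integral ?I) _")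
    by (intro integrable_integral integrable_continuous_real continuous_intros continuous_on_subset[OF cP]
        continuous_on_subset[OF cont]) auto
  have i2: "((\<lambda>t. poisson w (cis t) * Re (cnj (g w) * g (cis t))) has_integral 2 * pi * Re (cnj (g w) * g w)) {0..2*pi}"
    by (rule poisson_formula_Re[OF _ g(2) w]) (intro holomorphic_intros g)
  have i3: "((\<lambda>t. poisson w (cis t) * Re 1) has_integral 2 * pi * Re 1) {0..2*pi}"
    by (rule poisson_formula_Re[OF _ g(2) w]) (intro holomorphic_intros)
  have "((\<lambda>t. poisson w (cis t) * (cmod (g (cis t)))\<^sup>2 - 2 * (poisson w (cis t) * Re (cnj (g w) * g (cis t)))
        + (cmod (g w))\<^sup>2 * (poisson w (cis t) * Re 1)) has_integral
      ?I - 2 * (2 * pi * Re (cnj (g w) * g w)) + (cmod (g w))\<^sup>2 * (2 * pi * Re 1)) {0..2*pi}"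
    by (intro has_integral_add has_integral_diff has_integral_mult_right i1 i2 i3)
  moreover have "0 \<le> poisson w (cis t) * (cmod (g (cis t)))\<^sup>2 - 2 * (poisson w (cis t) * Re (cnj (g w) * g (cis t)))
        + (cmod (g w))\<^sup>2 * (poisson w (cis t) * Re 1)" for t
  proof -
    have "0 \<le> poisson w (cis t) * (cmod (g (cis t) - g w))\<^sup>2"
      using poisson_bounds(1)[of "cis t" w] w by simp
    also have "\<dots> = poisson w (cis t) * (cmod (g (cis t)))\<^sup>2 - 2 * (poisson w (cis t) * Re (cnj (g w) * g (cis t)))
        + (cmod (g w))\<^sup>2 * (poisson w (cis t) * Re 1)"
      unfolding cmod_power2 by (simp add: power2_eq_square algebra_simps)
    finally show ?thesis .
  qed
  ultimately have "0 \<le> ?I - 2 * (2 * pi * Re (cnj (g w) * g w)) + (cmod (g w))\<^sup>2 * (2 * pi * Re 1)"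
    by (rule has_integral_nonneg)
  moreover have "Re (cnj (g w) * g w) = (cmod (g w))\<^sup>2"
    unfolding cmod_power2 by (simp add: power2_eq_square)
  ultimately show ?thesis
    by simp
qed

section \<open>Boundedness of composition operators\<close>

lemma int_mean2_le_h2_norm:
  assumes "f \<in> H2" "r \<in> {0..<1}"
  shows "int_mean2 f r \<le> (h2_norm f)\<^sup>2"
proof -
  have "int_mean2 f r \<le> (SUP r\<in>{0..<1}. int_mean2 f r)"
    using assms by (intro cSUP_upper) (auto simp: H2_def)
  \<comment> \<open>Nonnegativity is what makes the square undo the \<open>sqrt\<close> in
    \<open>h2_norm\<close>. An integral that does not exist is 0 by convention, so both cases
    agree.\<close>
  moreover have "0 \<le> int_mean2 f r"
    unfolding int_mean2_def by (cases "(\<lambda>t. (cmod (f (of_real r * cis t)))\<^sup>2) integrable_on {0..2*pi}")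
      (auto intro!: divide_nonneg_pos integral_nonneg simp: not_integrable_integral)
  ultimately show ?thesis
    by (simp add: h2_norm_def)
qed

text \<open>Littlewood's subordination principle: the Poisson majorant of \<^term>\<open>\<lambda>z. (cmod (f z))\<^sup>2\<close> composed with
  \<^term>\<open>\<phi>\<close> is averaged by the mean value property.\<close>
lemma littlewood_mean:
  assumes \<phi>: "analytic_selfmap \<phi>" and f: "f \<in> H2" and r: "r \<in> {0..<1}" and R: "0 < R" "R < 1"
  shows "integral {0..2*pi} (\<lambda>s. (cmod (f (of_real R * \<phi> (of_real r * cis s))))\<^sup>2)
    \<le> 2 * pi * ((1 + cmod (\<phi> 0)) / (1 - cmod (\<phi> 0)) * (h2_norm f)\<^sup>2)"
proof -
  have \<phi>h: "\<phi> holomorphic_on ball 0 1" and \<phi>b: "\<And>z. cmod z < 1 \<Longrightarrow> cmod (\<phi> z) < 1"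
    using \<phi> unfolding analytic_selfmap_def by (auto simp: image_subset_iff)
  have fh: "f holomorphic_on ball 0 1"
    using f by (simp add: H2_def)
  define \<gamma> where "\<gamma> s = \<phi> (of_real r * cis s)" for s
  \<comment> \<open>The dilate by R is holomorphic beyond the closed disc, as the Poisson formula
    requires.\<close>
  define g where "g z = f (of_real R * z)" for z
  define C where "C = (1 + cmod (\<phi> 0)) / (1 - cmod (\<phi> 0))"
  have rc: "cmod (of_real r * cis s) < 1" for s
    using r by (simp add: norm_mult)
  have \<gamma>b: "cmod (\<gamma> s) < 1" for s
    unfolding \<gamma>_def by (intro \<phi>b rc)
  have c\<gamma>: "continuous_on UNIV \<gamma>"
    unfolding \<gamma>_def using rc
    by (intro continuous_on_compose2[OF holomorphic_on_imp_continuous_on[OF \<phi>h]] continuous_intros) auto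
  have gh: "g holomorphic_on ball 0 (1 / R)"
  proof -
    have "(f \<circ> (\<lambda>z. of_real R * z)) holomorphic_on ball 0 (1 / R)"
      using R by (intro holomorphic_on_compose_gen[OF _ fh] holomorphic_intros)
        (auto simp: norm_mult field_simps)
    then show ?thesis
      by (simp add: g_def[abs_def] o_def)
  qed
  have R1: "1 < 1 / R"
    using R by simp
  have cg: "continuous_on UNIV (\<lambda>t. g (cis t))"
    using R1 by (intro continuous_on_compose2[OF holomorphic_on_imp_continuous_on[OF gh]] continuous_intros) auto
  have cg\<gamma>: "continuous_on UNIV (\<lambda>s. g (\<gamma> s))"
    using R1 \<gamma>b less_trans by (intro continuous_on_compose2[OF holomorphic_on_imp_continuous_on[OF gh] c\<gamma>]) fastforce
  have ne: "cis t \<noteq> \<gamma> s" for s t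
    using \<gamma>b[of s] by (metis less_irrefl norm_cis)
  have cK: "continuous_on UNIV (\<lambda>(s, t). poisson (\<gamma> s) (cis t) * (cmod (g (cis t)))\<^sup>2)"
    unfolding poisson_def split_def using ne
    by (intro continuous_intros continuous_on_compose2[OF c\<gamma>] continuous_on_compose2[OF cg]) auto
  have int_s: "(\<lambda>s. poisson (\<gamma> s) (cis t)) integrable_on {0..2*pi}" for t
    unfolding poisson_def using ne
    by (intro integrable_continuous_real continuous_intros continuous_on_subset[OF c\<gamma>]) auto
  \<comment> \<open>For a fixed boundary point, \<open>poisson (\<phi> z) (cis t)\<close> is the
    real part of a holomorphic function of z, so its mean over the circle of radius r is its value
    at 0. The radius \<rho> only has to satisfy \<open>1 < \<rho>\<close> and
    \<open>r * \<rho> < 1\<close>.\<close>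
  have mean: "integral {0..2*pi} (\<lambda>s. poisson (\<gamma> s) (cis t)) = 2 * pi * poisson (\<phi> 0) (cis t)" for t
  proof -
    define \<rho> where "\<rho> = 2 / (1 + r)"
    have \<rho>: "1 < \<rho>" "r * \<rho> < 1"
      using r by (auto simp: \<rho>_def field_simps)
    have in1: "cmod (of_real r * z) < 1" if "z \<in> ball 0 \<rho>" for z
      using that \<rho>(2) r mult_left_mono[of "cmod z" \<rho> r] by (auto simp: norm_mult)
    have "(\<phi> \<circ> (\<lambda>z. of_real r * z)) holomorphic_on ball 0 \<rho>"
      using in1 by (intro holomorphic_on_compose_gen[OF _ \<phi>h] holomorphic_intros) auto
    then have h: "(\<lambda>z. \<phi> (of_real r * z)) holomorphic_on ball 0 \<rho>"
      by (simp add: o_def)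
    have "cis t - \<phi> (of_real r * z) \<noteq> 0" if "z \<in> ball 0 \<rho>" for z
      using \<phi>b[OF in1[OF that]] by (metis eq_iff_diff_eq_0 less_irrefl norm_cis)
    then have "(\<lambda>z. (cis t + \<phi> (of_real r * z)) / (cis t - \<phi> (of_real r * z))) holomorphic_on ball 0 \<rho>"
      by (intro holomorphic_intros h)
    from poisson_formula_Re[OF this \<rho>(1), of 0]
    have "((\<lambda>s. Re ((cis t + \<gamma> s) / (cis t - \<gamma> s))) has_integral
        2 * pi * Re ((cis t + \<phi> 0) / (cis t - \<phi> 0))) {0..2*pi}"
      by (simp add: poisson_0 \<gamma>_def)
    then show ?thesis
      using \<gamma>b \<phi>b[of 0] by (subst (1 2) poisson_eq_Re) (auto intro: integral_unique)
  qed
  have C0: "0 \<le> C" and PC: "poisson (\<phi> 0) (cis t) \<le> C" for t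
    using \<phi>b[of 0] poisson_bounds(2)[of "cis t" "\<phi> 0"] by (auto simp: C_def)
  have "2 * pi * integral {0..2*pi} (\<lambda>s. (cmod (g (\<gamma> s)))\<^sup>2) = integral {0..2*pi} (\<lambda>s. 2 * pi * (cmod (g (\<gamma> s)))\<^sup>2)"
    by simp
  also have "\<dots> \<le> integral {0..2*pi} (\<lambda>s. integral {0..2*pi} (\<lambda>t. poisson (\<gamma> s) (cis t) * (cmod (g (cis t)))\<^sup>2))"
  proof (rule integral_le)
    show "(\<lambda>s. 2 * pi * (cmod (g (\<gamma> s)))\<^sup>2) integrable_on {0..2*pi}"
      by (intro integrable_continuous_real continuous_intros continuous_on_subset[OF cg\<gamma>]) auto
    have "continuous_on (cbox 0 (2*pi)) (\<lambda>s. integral (cbox 0 (2*pi)) (\<lambda>t. poisson (\<gamma> s) (cis t) * (cmod (g (cis t)))\<^sup>2))"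
      by (rule integral_continuous_on_param) (rule continuous_on_subset[OF cK], simp)
    then show "(\<lambda>s. integral {0..2*pi} (\<lambda>t. poisson (\<gamma> s) (cis t) * (cmod (g (cis t)))\<^sup>2)) integrable_on {0..2*pi}"
      by (intro integrable_continuous_real) simp
    show "2 * pi * (cmod (g (\<gamma> s)))\<^sup>2 \<le> integral {0..2*pi} (\<lambda>t. poisson (\<gamma> s) (cis t) * (cmod (g (cis t)))\<^sup>2)" for s
      using \<gamma>b by (intro poisson_subharmonic[OF gh R1]) auto
  qed
  also have "\<dots> = integral {0..2*pi} (\<lambda>t. integral {0..2*pi} (\<lambda>s. poisson (\<gamma> s) (cis t) * (cmod (g (cis t)))\<^sup>2))"
    using integral_swap_continuous[of 0 0 "2*pi" "2*pi" "\<lambda>s t. poisson (\<gamma> s) (cis t) * (cmod (g (cis t)))\<^sup>2"]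
      continuous_on_subset[OF cK] by simp
  also have "\<dots> = integral {0..2*pi} (\<lambda>t. 2 * pi * poisson (\<phi> 0) (cis t) * (cmod (g (cis t)))\<^sup>2)"
    by (simp add: mean)
  also have "\<dots> \<le> integral {0..2*pi} (\<lambda>t. 2 * pi * C * (cmod (g (cis t)))\<^sup>2)"
  proof (rule integral_le)
    have "cis t \<noteq> \<phi> 0" for t
      using \<phi>b[of 0] by (metis less_irrefl norm_cis norm_zero zero_less_one)
    then show "(\<lambda>t. 2 * pi * poisson (\<phi> 0) (cis t) * (cmod (g (cis t)))\<^sup>2) integrable_on {0..2*pi}"
      unfolding poisson_def
      by (intro integrable_continuous_real continuous_intros continuous_on_subset[OF cg]) auto
    show "(\<lambda>t. 2 * pi * C * (cmod (g (cis t)))\<^sup>2) integrable_on {0..2*pi}"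
      by (intro integrable_continuous_real continuous_intros continuous_on_subset[OF cg]) auto
    show "2 * pi * poisson (\<phi> 0) (cis t) * (cmod (g (cis t)))\<^sup>2 \<le> 2 * pi * C * (cmod (g (cis t)))\<^sup>2" for t
      using PC by (intro mult_right_mono mult_left_mono) auto
  qed
  also have "\<dots> = 2 * pi * C * integral {0..2*pi} (\<lambda>t. (cmod (g (cis t)))\<^sup>2)"
    by simp
  also have "\<dots> = 2 * pi * (2 * pi * (C * int_mean2 f R))"
    by (simp add: int_mean2_def g_def)
  also have "\<dots> \<le> 2 * pi * (2 * pi * (C * (h2_norm f)\<^sup>2))"
    using int_mean2_le_h2_norm[OF f, of R] R C0 by (intro mult_left_mono) auto
  finally have "integral {0..2*pi} (\<lambda>s. (cmod (g (\<gamma> s)))\<^sup>2) \<le> 2 * pi * (C * (h2_norm f)\<^sup>2)"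
    by (rule mult_left_le_imp_le) simp
  then show ?thesis
    by (simp only: g_def \<gamma>_def C_def)
qed

text \<open>The dilation in \<open>littlewood_mean\<close> is removed by letting it tend to the
  identity on each fixed circle; the constant there depends neither on the dilation nor on the
  circle.\<close>

lemma composition_bounded:
  assumes \<phi>: "analytic_selfmap \<phi>" and f: "f \<in> H2"
  shows "f \<circ> \<phi> \<in> H2" "h2_norm (f \<circ> \<phi>) \<le> sqrt ((1 + cmod (\<phi> 0)) / (1 - cmod (\<phi> 0))) * h2_norm f"
proof -
  have \<phi>h: "\<phi> holomorphic_on ball 0 1" and \<phi>b: "\<And>z. cmod z < 1 \<Longrightarrow> cmod (\<phi> z) < 1"
    and \<phi>i: "\<phi> ` ball 0 1 \<subseteq> ball 0 1"
    using \<phi> unfolding analytic_selfmap_def by (auto simp: image_subset_iff)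
  have fh: "f holomorphic_on ball 0 1"
    using f by (simp add: H2_def)
  have fc: "continuous_on (ball 0 1) f"
    by (rule holomorphic_on_imp_continuous_on[OF fh])
  define C where "C = (1 + cmod (\<phi> 0)) / (1 - cmod (\<phi> 0))"
  have le: "int_mean2 (f \<circ> \<phi>) r \<le> C * (h2_norm f)\<^sup>2" if r: "r \<in> {0..<1}" for r
  proof -
    define \<gamma> where "\<gamma> s = \<phi> (of_real r * cis s)" for s
    have rc: "cmod (of_real r * cis s) < 1" for s
      using r by (simp add: norm_mult)
    have \<gamma>b: "cmod (\<gamma> s) < 1" for s
      unfolding \<gamma>_def by (intro \<phi>b rc)
    have c\<gamma>: "continuous_on UNIV \<gamma>"
      unfolding \<gamma>_def using rc
      by (intro continuous_on_compose2[OF holomorphic_on_imp_continuous_on[OF \<phi>h]] continuous_intros) auto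
    \<comment> \<open>The index shift keeps \<open>R n\<close> strictly positive, as
      \<open>littlewood_mean\<close> demands.\<close>
    define R where "R n = real (Suc n) / real (Suc (Suc n))" for n
    have R: "0 < R n" "R n < 1" for n
      by (auto simp: R_def)
    have Rlim: "R \<longlonglongrightarrow> 1"
      unfolding R_def by (rule LIMSEQ_Suc[OF LIMSEQ_n_over_Suc_n])
    \<comment> \<open>All dilates of the image curve lie in this one compact subset of the open
      disc, so f is bounded on them by a single constant, which dominates the integrands.\<close>
    define K where "K = (\<lambda>(x, s). of_real x * \<gamma> s) ` ({0..1} \<times> {0..2*pi})"
    have "compact K"
      unfolding K_def split_def
      by (intro compact_continuous_image compact_Times continuous_intros continuous_on_compose2[OF c\<gamma>]) auto
    moreover have "K \<subseteq> ball 0 1"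
    proof -
      have "cmod (of_real x * \<gamma> s) < 1" if "0 \<le> x" "x \<le> 1" for x s
        using mult_right_mono[of x 1 "cmod (\<gamma> s)"] that \<gamma>b[of s] by (simp add: norm_mult)
      then show ?thesis
        by (auto simp: K_def)
    qed
    ultimately have "compact (f ` K)"
      by (intro compact_continuous_image continuous_on_subset[OF fc])
    then obtain B where B: "\<And>u. u \<in> K \<Longrightarrow> cmod (f u) \<le> B"
      by (meson bounded_iff compact_imp_bounded imageI)
    have Kin: "of_real (R n) * \<gamma> s \<in> K" if "s \<in> {0..2*pi}" for n s
      unfolding K_def using that R[of n] by (intro image_eqI[of _ _ "(R n, s)"]) auto
    have cs: "continuous_on UNIV (\<lambda>s. f (of_real (R n) * \<gamma> s))" for n
    proof (intro continuous_on_compose2[OF fc] continuous_intros c\<gamma>)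
      have "cmod (of_real (R n) * \<gamma> s) < 1" for s
        using mult_right_mono[of "R n" 1 "cmod (\<gamma> s)"] R[of n] \<gamma>b[of s] by (simp add: norm_mult)
      then show "(\<lambda>s. of_real (R n) * \<gamma> s) ` UNIV \<subseteq> ball 0 1"
        by auto
    qed
    have "(\<lambda>n. integral {0..2*pi} (\<lambda>s. (cmod (f (of_real (R n) * \<gamma> s)))\<^sup>2))
        \<longlonglongrightarrow> integral {0..2*pi} (\<lambda>s. (cmod (f (\<gamma> s)))\<^sup>2)"
    proof (rule dominated_convergence(2)[where h = "\<lambda>_. B\<^sup>2"])
      show "(\<lambda>s. (cmod (f (of_real (R n) * \<gamma> s)))\<^sup>2) integrable_on {0..2*pi}" for n
        by (intro integrable_continuous_real continuous_intros continuous_on_subset[OF cs]) auto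
      show "norm ((cmod (f (of_real (R n) * \<gamma> s)))\<^sup>2) \<le> B\<^sup>2" if "s \<in> {0..2*pi}" for n s
        using B[OF Kin[OF that]] by (simp add: power_mono)
      show "(\<lambda>n. (cmod (f (of_real (R n) * \<gamma> s)))\<^sup>2) \<longlonglongrightarrow> (cmod (f (\<gamma> s)))\<^sup>2" for s
      proof -
        have "isCont f (\<gamma> s)"
          using fc \<gamma>b[of s] by (simp add: continuous_on_eq_continuous_at)
        moreover have "(\<lambda>n. of_real (R n) * \<gamma> s) \<longlonglongrightarrow> of_real 1 * \<gamma> s"
          by (intro tendsto_intros Rlim)
        ultimately show ?thesis
          using isCont_tendsto_compose[of "\<gamma> s" f] by (intro tendsto_intros) simp
      qed
    qed auto
    then have "integral {0..2*pi} (\<lambda>s. (cmod (f (\<gamma> s)))\<^sup>2) \<le> 2 * pi * (C * (h2_norm f)\<^sup>2)"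
      by (rule tendsto_upperbound)
        (use littlewood_mean[OF \<phi> f r R] in \<open>auto simp: \<gamma>_def C_def\<close>)
    then show ?thesis
      unfolding int_mean2_def by (simp add: \<gamma>_def field_simps)
  qed
  have "(f \<circ> \<phi>) holomorphic_on ball 0 1"
    by (rule holomorphic_on_compose_gen[OF \<phi>h fh \<phi>i])
  moreover have "bdd_above (int_mean2 (f \<circ> \<phi>) ` {0..<1})"
    using le by (rule bdd_aboveI2)
  ultimately show "f \<circ> \<phi> \<in> H2"
    by (simp only: H2_def mem_Collect_eq)
  have "(SUP r\<in>{0..<1}. int_mean2 (f \<circ> \<phi>) r) \<le> C * (h2_norm f)\<^sup>2"
    using le by (intro cSUP_least) auto
  then have "h2_norm (f \<circ> \<phi>) \<le> sqrt (C * (h2_norm f)\<^sup>2)"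
    unfolding h2_norm_def[of "f \<circ> \<phi>"] by (rule real_sqrt_le_mono)
  also have "\<dots> = sqrt C * h2_norm f"
    using h2_norm_nonneg[OF f] by (simp add: real_sqrt_mult)
  finally show "h2_norm (f \<circ> \<phi>) \<le> sqrt ((1 + cmod (\<phi> 0)) / (1 - cmod (\<phi> 0))) * h2_norm f"
    by (simp add: C_def)
qed

section \<open>Uniqueness of Poisson representations\<close>

definition circle_measure :: "complex measure \<Rightarrow> bool" where
  "circle_measure \<mu> \<longleftrightarrow> sets \<mu> = sets (restrict_space borel (sphere 0 1)) \<and> finite_measure \<mu>"

lemma space_circle_measure: "circle_measure \<mu> \<Longrightarrow> space \<mu> = sphere 0 1"
  using sets_eq_imp_space_eq[of \<mu> "restrict_space borel (sphere 0 1)"]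
  by (simp add: circle_measure_def space_restrict_space)

lemma circle_measure_measurable:
  fixes f :: "complex \<Rightarrow> 'b::topological_space"
  assumes "circle_measure \<mu>" "continuous_on (sphere 0 1) f"
  shows "f \<in> borel_measurable \<mu>"
  using borel_measurable_continuous_on_restrict[OF assms(2)] assms(1)
  unfolding circle_measure_def by (simp cong: measurable_cong_sets)

lemma circle_measure_integrable:
  fixes f :: "complex \<Rightarrow> 'b::{banach, second_countable_topology}"
  assumes \<mu>: "circle_measure \<mu>" and f: "continuous_on (sphere 0 1) f"
  shows "integrable \<mu> f"
proof -
  interpret finite_measure \<mu>
    using \<mu> by (simp add: circle_measure_def)
  have "compact (f ` sphere 0 1)"
    by (intro compact_continuous_image f) simp
  then obtain B where "\<And>x. x \<in> sphere 0 1 \<Longrightarrow> norm (f x) \<le> B"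
    by (meson bounded_iff compact_imp_bounded imageI)
  then show ?thesis
    using circle_measure_measurable[OF \<mu> f] space_circle_measure[OF \<mu>]
    by (intro integrable_const_bound[of _ B]) auto
qed

section \<open>Herglotz integrals and moments\<close>

definition herglotz :: "complex measure \<Rightarrow> complex \<Rightarrow> complex" where
  "herglotz \<mu> z = (\<integral>\<zeta>. (\<zeta> + z) / (\<zeta> - z) \<partial>\<mu>)"

lemma continuous_on_herglotz_kernel:
  fixes z :: complex
  assumes "z \<in> ball 0 1"
  shows "continuous_on (sphere 0 1) (\<lambda>\<zeta>. (\<zeta> + z) / (\<zeta> - z))"
  using assms by (intro continuous_intros) auto

lemma Re_herglotz:
  assumes \<mu>: "circle_measure \<mu>" and z: "z \<in> ball 0 1"
  shows "Re (herglotz \<mu> z) = (\<integral>\<zeta>. poisson z \<zeta> \<partial>\<mu>)"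
proof -
  have "Re (herglotz \<mu> z) = (\<integral>\<zeta>. Re ((\<zeta> + z) / (\<zeta> - z)) \<partial>\<mu>)"
    unfolding herglotz_def
    by (rule integral_bounded_linear[OF bounded_linear_Re, symmetric])
      (intro circle_measure_integrable[OF \<mu>] continuous_on_herglotz_kernel z)
  also have "\<dots> = (\<integral>\<zeta>. poisson z \<zeta> \<partial>\<mu>)"
    using z space_circle_measure[OF \<mu>] by (intro Bochner_Integration.integral_cong) (auto simp: poisson_eq_Re)
  finally show ?thesis .
qed

text \<open>On the circle the kernel expands as 1 plus twice the sum of
  \<open>(cnj \<zeta> * z) ^ n\<close> over n \<ge> 1. Hence the Taylor coefficients are, up to the
  factor 2, the moments of the measure, and knowing the function means knowing the moments.\<close>

lemma herglotz_series:
  assumes \<mu>: "circle_measure \<mu>"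
  shows "disc_series (\<lambda>n. (if n = 0 then 1 else 2) * (\<integral>\<zeta>. cnj \<zeta> ^ n \<partial>\<mu>)) (herglotz \<mu>)"
  unfolding disc_series_def
proof
  fix z :: complex assume z: "z \<in> ball 0 1"
  then have z1: "cmod z < 1"
    by simp
  interpret finite_measure \<mu>
    using \<mu> by (simp add: circle_measure_def)
  define c :: "nat \<Rightarrow> complex" where "c n = (if n = 0 then 1 else 2)" for n
  define t where "t n \<zeta> = c n * (cnj \<zeta> * z) ^ n" for n \<zeta>
  have c: "cmod (c n) \<le> 2" for n
    by (simp add: c_def)
  have nt: "cmod (t n \<zeta>) \<le> 2 * cmod z ^ n" if "\<zeta> \<in> sphere 0 1" for n \<zeta>
    using that c[of n] by (auto simp: t_def norm_mult norm_power intro!: mult_right_mono)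
  have geo: "summable (\<lambda>n. 2 * cmod z ^ n)"
    using z1 by (intro summable_mult summable_geometric) auto
  have int: "integrable \<mu> (t n)" for n
    unfolding t_def by (intro circle_measure_integrable[OF \<mu>] continuous_intros)
  have pt: "(\<lambda>n. t n \<zeta>) sums ((\<zeta> + z) / (\<zeta> - z))" if "\<zeta> \<in> sphere 0 1" for \<zeta>
  proof -
    have n1: "cmod \<zeta> = 1"
      using that by simp
    have *: "\<zeta> * cnj \<zeta> = 1"
      using n1 by (metis complex_norm_square of_real_1 one_power2)
    have "cmod (cnj \<zeta> * z) < 1"
      using n1 z1 by (simp add: norm_mult)
    then have "(\<lambda>n. 2 * (cnj \<zeta> * z) ^ n - (if n = 0 then 1 else 0)) sums (2 * (1 / (1 - cnj \<zeta> * z)) - 1)"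
      by (intro sums_diff sums_mult geometric_sums sums_single[where i=0, simplified])
    moreover have "2 * (cnj \<zeta> * z) ^ n - (if n = 0 then 1 else 0) = t n \<zeta>" for n
      by (simp add: t_def c_def)
    moreover have "2 * (1 / (1 - cnj \<zeta> * z)) - 1 = (\<zeta> + z) / (\<zeta> - z)"
    proof -
      have "\<zeta> * (1 - cnj \<zeta> * z) = \<zeta> - z"
        using * by (simp add: right_diff_distrib mult.assoc[symmetric])
      moreover have "\<zeta> \<noteq> 0" "\<zeta> - z \<noteq> 0"
        using n1 z1 by auto
      ultimately have "1 / (1 - cnj \<zeta> * z) = \<zeta> / (\<zeta> - z)"
        by (metis mult_divide_mult_cancel_left mult.right_neutral)
      then have "2 * (1 / (1 - cnj \<zeta> * z)) - 1 = 2 * (\<zeta> / (\<zeta> - z)) - 1"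
        by (simp only:)
      also have "\<dots> = (\<zeta> + z) / (\<zeta> - z)"
        using \<open>\<zeta> - z \<noteq> 0\<close> by (simp add: field_simps)
      finally show ?thesis .
    qed
    ultimately show ?thesis
      by simp
  qed
  have "(\<lambda>n. integral\<^sup>L \<mu> (t n)) sums (\<integral>\<zeta>. (\<Sum>n. t n \<zeta>) \<partial>\<mu>)"
  proof (rule sums_integral[OF int])
    show "AE \<zeta> in \<mu>. summable (\<lambda>n. norm (t n \<zeta>))"
      using nt by (intro AE_I2 summable_comparison_test'[OF geo]) (auto simp: space_circle_measure[OF \<mu>])
    have le: "(\<integral>\<zeta>. norm (t n \<zeta>) \<partial>\<mu>) \<le> (\<integral>\<zeta>. 2 * cmod z ^ n \<partial>\<mu>)" for n
      using nt int by (intro integral_mono) (auto simp: space_circle_measure[OF \<mu>])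
    have "summable (\<lambda>n. \<integral>\<zeta>. 2 * cmod z ^ n \<partial>\<mu>)"
      using summable_mult[OF geo, of "measure \<mu> (space \<mu>)"] by simp
    moreover have "norm (\<integral>\<zeta>. norm (t n \<zeta>) \<partial>\<mu>) \<le> (\<integral>\<zeta>. 2 * cmod z ^ n \<partial>\<mu>)" for n
    proof -
      have "0 \<le> (\<integral>\<zeta>. norm (t n \<zeta>) \<partial>\<mu>)"
        by (rule integral_nonneg_AE) simp
      then show ?thesis
        unfolding real_norm_def using le[of n] by linarith
    qed
    ultimately show "summable (\<lambda>n. \<integral>\<zeta>. norm (t n \<zeta>) \<partial>\<mu>)"
      by (rule summable_comparison_test')
  qed
  moreover have "(\<integral>\<zeta>. (\<Sum>n. t n \<zeta>) \<partial>\<mu>) = herglotz \<mu> z"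
    unfolding herglotz_def using pt
    by (intro Bochner_Integration.integral_cong) (auto simp: space_circle_measure[OF \<mu>] sums_iff)
  moreover have "integral\<^sup>L \<mu> (t n) = c n * (\<integral>\<zeta>. cnj \<zeta> ^ n \<partial>\<mu>) * z ^ n" for n
  proof -
    have "integral\<^sup>L \<mu> (t n) = (\<integral>\<zeta>. (c n * z ^ n) * cnj \<zeta> ^ n \<partial>\<mu>)"
      by (simp add: t_def[abs_def] power_mult_distrib mult_ac)
    also have "\<dots> = (c n * z ^ n) * (\<integral>\<zeta>. cnj \<zeta> ^ n \<partial>\<mu>)"
      by (rule integral_mult_right_zero)
    finally show ?thesis
      by (simp add: mult_ac)
  qed
  ultimately show "(\<lambda>n. (if n = 0 then 1 else 2) * (\<integral>\<zeta>. cnj \<zeta> ^ n \<partial>\<mu>) * z ^ n) sums herglotz \<mu> z"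
    by (simp add: c_def)
qed

lemma herglotz_holomorphic: "circle_measure \<mu> \<Longrightarrow> herglotz \<mu> holomorphic_on ball 0 1"
  by (rule disc_series_imp_holomorphic[OF herglotz_series])

text \<open>The difference of the two Herglotz integrals has real part 0 and is therefore constant,
  so its coefficients of positive index vanish. The moment of index 0 is the total mass, which is
  the Poisson integral at the origin.\<close>

lemma moments_eq_of_poisson_eq:
  assumes \<mu>: "circle_measure \<mu>" and \<nu>: "circle_measure \<nu>"
    and eq: "\<And>z. z \<in> ball 0 1 \<Longrightarrow> (\<integral>\<zeta>. poisson z \<zeta> \<partial>\<mu>) = (\<integral>\<zeta>. poisson z \<zeta> \<partial>\<nu>)"
  shows "(\<integral>\<zeta>. cnj \<zeta> ^ n \<partial>\<mu>) = (\<integral>\<zeta>. cnj \<zeta> ^ n \<partial>\<nu>)"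
proof (cases "n = 0")
  case True
  have "(\<integral>\<zeta>. poisson 0 \<zeta> \<partial>\<kappa>) = (\<integral>\<zeta>. 1 \<partial>\<kappa>)" if "circle_measure \<kappa>" for \<kappa>
    using space_circle_measure[OF that] by (intro Bochner_Integration.integral_cong) (auto simp: poisson_0)
  then have "measure \<mu> (space \<mu>) = measure \<nu> (space \<nu>)"
    using \<mu> \<nu> eq[of 0] by simp
  then show ?thesis
    using True by simp
next
  case False
  define a where "a n = (if n = 0 then 1 else 2) * ((\<integral>\<zeta>. cnj \<zeta> ^ n \<partial>\<mu>) - (\<integral>\<zeta>. cnj \<zeta> ^ n \<partial>\<nu>))" for n
  define d where "d z = herglotz \<mu> z - herglotz \<nu> z" for z
  have d: "disc_series a d"
    unfolding disc_series_def
  proof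
    fix z :: complex assume z: "z \<in> ball 0 1"
    from sums_diff[OF herglotz_series[OF \<mu>, unfolded disc_series_def, rule_format, OF z]
        herglotz_series[OF \<nu>, unfolded disc_series_def, rule_format, OF z]]
    show "(\<lambda>n. a n * z ^ n) sums d z"
      by (simp add: a_def d_def algebra_simps)
  qed
  have "Re (d z) = 0" if "z \<in> ball 0 1" for z
    using that eq[OF that] by (simp add: d_def Re_herglotz \<mu> \<nu>)
  then have const: "d z = d 0" if "z \<in> ball 0 1" for z
    using holomorphic_Re_zero_constant[OF disc_series_imp_holomorphic[OF d]] that by blast
  have "a n = 0"
  proof (rule ccontr)
    assume "a n \<noteq> 0"
    \<comment> \<open>Without its constant term the series sums to 0 on the whole disc, whereas a
      nonzero coefficient would make 0 an isolated zero.\<close>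
    define b where "b m = (if m = 0 then 0 else a m)" for m
    have "(\<lambda>m. b m * (x - 0) ^ m) sums (0::complex)" if x: "norm (x - 0) < 1" for x :: complex
    proof -
      have "(\<lambda>m. a m * x ^ m) sums d x"
        using d x by (simp add: disc_series_def)
      moreover have "(\<lambda>m. a m * 0 ^ m) sums d 0"
        using d[unfolded disc_series_def, rule_format, of 0] by simp
      ultimately have "(\<lambda>m. a m * x ^ m - a m * 0 ^ m) sums (d x - d 0)"
        by (rule sums_diff)
      moreover have "a m * x ^ m - a m * 0 ^ m = b m * (x - 0) ^ m" for m
        by (simp add: b_def)
      ultimately show ?thesis
        using const[of x] x by simp
    qed
    then obtain s where "0 < s" "\<And>z. z \<in> cball 0 s - {0::complex} \<Longrightarrow> (\<lambda>_. 0 :: complex) z \<noteq> 0"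
      using powser_0_nonzero[of 1 0 b "\<lambda>_. 0" n] \<open>a n \<noteq> 0\<close> False by (auto simp: b_def)
    from this(2)[of "of_real s"] this(1) show False
      by simp
  qed
  then show ?thesis
    using False by (simp add: a_def)
qed

section \<open>From moments to continuous functions and to the measure\<close>

inductive bipolynomial :: "(complex \<Rightarrow> complex) \<Rightarrow> bool" where
  monom: "bipolynomial (\<lambda>\<zeta>. c * (\<zeta> ^ i * cnj \<zeta> ^ j))"
| add: "bipolynomial f \<Longrightarrow> bipolynomial g \<Longrightarrow> bipolynomial (\<lambda>\<zeta>. f \<zeta> + g \<zeta>)"

lemma bipolynomial_continuous: "bipolynomial f \<Longrightarrow> continuous_on S f"
  by (induction rule: bipolynomial.induct) (auto intro!: continuous_intros)

lemma bipolynomial_monom_mult: "bipolynomial g \<Longrightarrow> bipolynomial (\<lambda>\<zeta>. c * (\<zeta> ^ i * cnj \<zeta> ^ j) * g \<zeta>)"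
proof (induction rule: bipolynomial.induct)
  case (monom c' i' j')
  show ?case
    using bipolynomial.monom[of "c * c'" "i + i'" "j + j'"] by (simp add: power_add mult_ac)
next
  case (add f g)
  then show ?case
    using bipolynomial.add[OF add.IH] by (simp add: distrib_left)
qed

lemma bipolynomial_mult: "bipolynomial f \<Longrightarrow> bipolynomial g \<Longrightarrow> bipolynomial (\<lambda>\<zeta>. f \<zeta> * g \<zeta>)"
proof (induction rule: bipolynomial.induct)
  case (monom c i j)
  then show ?case
    by (rule bipolynomial_monom_mult)
next
  case (add f h)
  then show ?case
    using bipolynomial.add[OF add.IH] by (simp add: distrib_right)
qed

lemma real_polynomial_bipolynomial:
  fixes p :: "complex \<Rightarrow> real"
  shows "real_polynomial_function p \<Longrightarrow> bipolynomial (\<lambda>\<zeta>. of_real (p \<zeta>))"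
proof (induction rule: real_polynomial_function.induct)
  case (linear f)
  interpret bounded_linear f
    by fact
  \<comment> \<open>A real-linear functional is
    \<open>Re \<zeta> * f 1 + Im \<zeta> * f \<i>\<close>; expressing both parts through \<zeta> and
    its conjugate gives these coefficients.\<close>
  have "complex_of_real (f \<zeta>) = (f 1 / 2 - \<i> * f \<i> / 2) * (\<zeta> ^ 1 * cnj \<zeta> ^ 0) + (f 1 / 2 + \<i> * f \<i> / 2) * (\<zeta> ^ 0 * cnj \<zeta> ^ 1)" for \<zeta>
  proof -
    have "f (Re \<zeta> *\<^sub>R 1 + Im \<zeta> *\<^sub>R \<i>) = Re \<zeta> * f 1 + Im \<zeta> * f \<i>"
      by (simp only: add scale real_scaleR_def)
    moreover have "Re \<zeta> *\<^sub>R 1 + Im \<zeta> *\<^sub>R \<i> = \<zeta>"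
      by (simp add: complex_eq_iff)
    ultimately have "f \<zeta> = Re \<zeta> * f 1 + Im \<zeta> * f \<i>"
      by (simp only:)
    then show ?thesis
      by (simp add: complex_eq_iff algebra_simps)
  qed
  then have eq: "(\<lambda>\<zeta>. complex_of_real (f \<zeta>)) = (\<lambda>\<zeta>. (f 1 / 2 - \<i> * f \<i> / 2) * (\<zeta> ^ 1 * cnj \<zeta> ^ 0) +
      (f 1 / 2 + \<i> * f \<i> / 2) * (\<zeta> ^ 0 * cnj \<zeta> ^ 1))"
    by (rule ext)
  show ?case
    by (subst eq) (rule bipolynomial.add[OF bipolynomial.monom bipolynomial.monom])
next
  case (const c)
  then show ?case
    using bipolynomial.monom[of "of_real c" 0 0] by simp
next
  case (add f g)
  then show ?case
    using bipolynomial.add[OF add.IH] by simp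
next
  case (mult f g)
  then show ?case
    using bipolynomial_mult[OF mult.IH] by simp
qed

text \<open>Since \<open>\<zeta> * cnj \<zeta> = 1\<close> on the circle, every monomial collapses
  there to a power of \<open>cnj \<zeta>\<close> or to the conjugate of one, so its integral is a
  moment or the conjugate of a moment.\<close>

lemma bipolynomial_integral_eq:
  assumes \<mu>: "circle_measure \<mu>" and \<nu>: "circle_measure \<nu>"
    and eq: "\<And>n. (\<integral>\<zeta>. cnj \<zeta> ^ n \<partial>\<mu>) = (\<integral>\<zeta>. cnj \<zeta> ^ n \<partial>\<nu>)"
  shows "bipolynomial f \<Longrightarrow> integral\<^sup>L \<mu> f = integral\<^sup>L \<nu> f"
proof (induction rule: bipolynomial.induct)
  case (monom c i j)
  have red: "\<zeta> ^ i * cnj \<zeta> ^ j = (if i \<le> j then cnj \<zeta> ^ (j - i) else cnj (cnj \<zeta> ^ (i - j)))" if "\<zeta> \<in> sphere 0 1" for \<zeta>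
  proof -
    have *: "\<zeta> * cnj \<zeta> = 1"
      using that by (metis complex_norm_square mem_sphere_0 of_real_1 one_power2)
    then have **: "\<zeta> ^ k * cnj \<zeta> ^ k = 1" for k
      by (metis power_mult_distrib power_one)
    show ?thesis
    proof (cases "i \<le> j")
      case True
      then have "\<zeta> ^ i * cnj \<zeta> ^ j = (\<zeta> ^ i * cnj \<zeta> ^ i) * cnj \<zeta> ^ (j - i)"
        by (simp add: power_add[symmetric] mult.assoc)
      then show ?thesis
        using True ** by simp
    next
      case False
      then have "\<zeta> ^ i * cnj \<zeta> ^ j = (\<zeta> ^ j * cnj \<zeta> ^ j) * \<zeta> ^ (i - j)"
        by (simp add: power_add[symmetric] mult_ac)
      then show ?thesis
        using False ** by simp
    qed
  qed
  have "(\<integral>\<zeta>. \<zeta> ^ i * cnj \<zeta> ^ j \<partial>\<kappa>) =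
      (\<integral>\<zeta>. (if i \<le> j then cnj \<zeta> ^ (j - i) else cnj (cnj \<zeta> ^ (i - j))) \<partial>\<kappa>)" if "circle_measure \<kappa>" for \<kappa>
    using red space_circle_measure[OF that] by (intro Bochner_Integration.integral_cong) auto
  moreover have "(\<integral>\<zeta>. (if i \<le> j then cnj \<zeta> ^ (j - i) else cnj (cnj \<zeta> ^ (i - j))) \<partial>\<kappa>) =
      (if i \<le> j then (\<integral>\<zeta>. cnj \<zeta> ^ (j - i) \<partial>\<kappa>) else cnj (\<integral>\<zeta>. cnj \<zeta> ^ (i - j) \<partial>\<kappa>))" for \<kappa>
    by (simp del: complex_cnj_power)
  ultimately have "(\<integral>\<zeta>. \<zeta> ^ i * cnj \<zeta> ^ j \<partial>\<mu>) = (\<integral>\<zeta>. \<zeta> ^ i * cnj \<zeta> ^ j \<partial>\<nu>)"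
    using \<mu> \<nu> eq by presburger
  then show ?case
    by simp
next
  case (add f g)
  have "integrable \<kappa> f" "integrable \<kappa> g" if "circle_measure \<kappa>" for \<kappa>
    using that add.hyps by (auto intro!: circle_measure_integrable bipolynomial_continuous)
  then show ?case
    using \<mu> \<nu> add.IH by (simp add: Bochner_Integration.integral_add)
qed

lemma continuous_integral_eq:
  fixes f :: "complex \<Rightarrow> real"
  assumes \<mu>: "circle_measure \<mu>" and \<nu>: "circle_measure \<nu>"
    and eq: "\<And>n. (\<integral>\<zeta>. cnj \<zeta> ^ n \<partial>\<mu>) = (\<integral>\<zeta>. cnj \<zeta> ^ n \<partial>\<nu>)"
    and f: "continuous_on (sphere 0 1) f"
  shows "integral\<^sup>L \<mu> f = integral\<^sup>L \<nu> f"
proof -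
  have approx: "\<bar>integral\<^sup>L \<kappa> f - integral\<^sup>L \<kappa> p\<bar> \<le> e * measure \<kappa> (space \<kappa>)"
    if \<kappa>: "circle_measure \<kappa>" and p: "continuous_on (sphere 0 1) p" "\<And>x. x \<in> sphere 0 1 \<Longrightarrow> \<bar>f x - p x\<bar> < e" for \<kappa> p e
  proof -
    interpret finite_measure \<kappa>
      using \<kappa> by (simp add: circle_measure_def)
    have i: "integrable \<kappa> f" "integrable \<kappa> p"
      using circle_measure_integrable \<kappa> f p by auto
    then have "\<bar>integral\<^sup>L \<kappa> f - integral\<^sup>L \<kappa> p\<bar> = \<bar>\<integral>x. f x - p x \<partial>\<kappa>\<bar>"
      by simp
    also have "\<dots> \<le> (\<integral>x. \<bar>f x - p x\<bar> \<partial>\<kappa>)"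
      by (rule integral_abs_bound)
    also have "\<dots> \<le> (\<integral>x. e \<partial>\<kappa>)"
      using i p(2) by (intro integral_mono) (auto simp: space_circle_measure[OF \<kappa>] intro: less_imp_le)
    finally show ?thesis
      by (simp add: mult.commute)
  qed
  \<comment> \<open>The summand 1 keeps \<open>C\<close> positive even if both measures vanish, so
    \<open>e / C\<close> is a legitimate accuracy.\<close>
  define C where "C = measure \<mu> (space \<mu>) + measure \<nu> (space \<nu>) + 1"
  have C: "C > 0"
    by (simp add: C_def add_nonneg_pos)
  have "\<bar>integral\<^sup>L \<mu> f - integral\<^sup>L \<nu> f\<bar> \<le> e" if e: "e > 0" for e
  proof -
    obtain p where p: "real_polynomial_function p" "\<And>x. x \<in> sphere 0 1 \<Longrightarrow> \<bar>f x - p x\<bar> < e / C"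
      using Stone_Weierstrass_real_polynomial_function[OF _ f, of "e / C"] e C by auto
    have b: "bipolynomial (\<lambda>\<zeta>. of_real (p \<zeta>))"
      using real_polynomial_bipolynomial p by blast
    have pc: "continuous_on (sphere 0 1) p"
      using continuous_on_Re[OF bipolynomial_continuous[OF b]] by simp
    have "complex_of_real (integral\<^sup>L \<mu> p) = complex_of_real (integral\<^sup>L \<nu> p)"
      using bipolynomial_integral_eq[OF \<mu> \<nu> eq b] by simp
    then have "integral\<^sup>L \<mu> p = integral\<^sup>L \<nu> p"
      using of_real_eq_iff by blast
    then have "\<bar>integral\<^sup>L \<mu> f - integral\<^sup>L \<nu> f\<bar> \<le> e / C * measure \<mu> (space \<mu>) + e / C * measure \<nu> (space \<nu>)"
      using approx[OF \<mu> pc p(2)] approx[OF \<nu> pc p(2)] by linarith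
    also have "\<dots> \<le> e / C * C"
      unfolding distrib_left[symmetric] using e C by (intro mult_left_mono) (auto simp: C_def)
    finally show ?thesis
      using C by simp
  qed
  from this[of "\<bar>integral\<^sup>L \<mu> f - integral\<^sup>L \<nu> f\<bar> / 2"] show ?thesis
    by (cases "integral\<^sup>L \<mu> f = integral\<^sup>L \<nu> f") auto
qed

text \<open>Continuous cutoffs built from the distance to a closed set decrease to its indicator, so
  the measures agree on closed sets. These are stable under intersection and generate the Borel sets
  of the plane, to which both measures are pushed forward.\<close>

lemma circle_measure_eqI:
  assumes \<mu>: "circle_measure \<mu>" and \<nu>: "circle_measure \<nu>"
    and eq: "\<And>f :: complex \<Rightarrow> real. continuous_on (sphere 0 1) f \<Longrightarrow> integral\<^sup>L \<mu> f = integral\<^sup>L \<nu> f"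
  shows "\<mu> = \<nu>"
proof -
  have lim: "(\<lambda>n. \<integral>x. max 0 (1 - real n * infdist x C) \<partial>\<kappa>) \<longlonglongrightarrow> measure \<kappa> (C \<inter> sphere 0 1)"
    if \<kappa>: "circle_measure \<kappa>" and C: "closed C" "C \<noteq> {}" for \<kappa> C
  proof -
    interpret finite_measure \<kappa>
      using \<kappa> by (simp add: circle_measure_def)
    have sets: "C \<inter> sphere 0 1 \<in> sets \<kappa>"
      using \<kappa> C by (auto simp: circle_measure_def sets_restrict_space)
    have "(\<lambda>n. \<integral>x. max 0 (1 - real n * infdist x C) \<partial>\<kappa>) \<longlonglongrightarrow> (\<integral>x. indicator (C \<inter> sphere 0 1) x \<partial>\<kappa>)"
    proof (rule integral_dominated_convergence[where w = "\<lambda>_. 1"])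
      show "(\<lambda>x. max 0 (1 - real n * infdist x C)) \<in> borel_measurable \<kappa>" for n
        by (intro circle_measure_measurable[OF \<kappa>] continuous_intros)
      show "AE x in \<kappa>. (\<lambda>n. max 0 (1 - real n * infdist x C)) \<longlonglongrightarrow> indicator (C \<inter> sphere 0 1) x"
      proof (rule AE_I2)
        fix x assume x: "x \<in> space \<kappa>"
        show "(\<lambda>n. max 0 (1 - real n * infdist x C)) \<longlonglongrightarrow> indicator (C \<inter> sphere 0 1) x"
        proof (cases "x \<in> C")
          case True
          then show ?thesis
            using x by (simp add: space_circle_measure[OF \<kappa>])
        next
          case False
          then have pos: "infdist x C > 0"
            using C by (simp add: infdist_pos_not_in_closed)
          obtain N :: nat where "1 / infdist x C \<le> real N"
            using real_arch_simple by blast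
          then have N: "1 \<le> real N * infdist x C"
            using pos by (simp add: field_simps)
          have "max 0 (1 - real n * infdist x C) = 0" if "n \<ge> N" for n
          proof -
            have "real N * infdist x C \<le> real n * infdist x C"
              using pos that by (intro mult_right_mono) auto
            then show ?thesis
              using N by linarith
          qed
          then show ?thesis
            using False by (intro tendsto_eventually) (auto simp: eventually_sequentially)
        qed
      qed
      show "AE x in \<kappa>. norm (max 0 (1 - real n * infdist x C)) \<le> 1" for n
        by (auto simp: infdist_nonneg)
    qed (use sets in auto)
    then show ?thesis
      using sets by simp
  qed
  have closed_eq: "measure \<mu> (C \<inter> sphere 0 1) = measure \<nu> (C \<inter> sphere 0 1)" if "closed C" for C
  \<comment> \<open>\<open>infdist x {}\<close> is 0 by convention, so the cutoffs of the empty set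
    would be constantly 1; it is treated apart.\<close>
  proof (cases "C = {}")
    case False
    have "(\<integral>x. max 0 (1 - real n * infdist x C) \<partial>\<mu>) = (\<integral>x. max 0 (1 - real n * infdist x C) \<partial>\<nu>)" for n
      by (intro eq continuous_intros)
    then show ?thesis
      using lim[OF \<mu> that False] lim[OF \<nu> that False] by (simp add: LIMSEQ_unique)
  qed simp
  have id: "(\<lambda>x. x) \<in> \<kappa> \<rightarrow>\<^sub>M borel" if "circle_measure \<kappa>" for \<kappa>
    by (intro circle_measure_measurable[OF that] continuous_intros)
  have emeas: "emeasure (distr \<kappa> borel (\<lambda>x. x)) X = ennreal (measure \<kappa> (X \<inter> sphere 0 1))"
    if "circle_measure \<kappa>" "X \<in> sets borel" for \<kappa> X
  proof -
    interpret finite_measure \<kappa>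
      using that by (simp add: circle_measure_def)
    show ?thesis
      using emeasure_distr[OF id[OF that(1)] that(2)]
      by (simp add: space_circle_measure[OF that(1)] emeasure_eq_measure vimage_def)
  qed
  have *: "distr \<mu> borel (\<lambda>x. x) = distr \<nu> borel (\<lambda>x. x)"
  proof (rule measure_eqI_generator_eq[where E = "Collect closed" and \<Omega> = UNIV and A = "\<lambda>_. UNIV"])
    show "Int_stable (Collect closed :: complex set set)"
      by (auto simp: Int_stable_def)
    show "emeasure (distr \<mu> borel (\<lambda>x. x)) X = emeasure (distr \<nu> borel (\<lambda>x. x)) X" if "X \<in> Collect closed" for X
      using that emeas[OF \<mu>, of X] emeas[OF \<nu>, of X] closed_eq[of X] by simp
    show "emeasure (distr \<mu> borel (\<lambda>x. x)) UNIV \<noteq> \<infinity>" for i :: nat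
      using emeas[OF \<mu>, of UNIV] by simp
    show "sets (distr \<mu> borel (\<lambda>x. x)) = sigma_sets UNIV (Collect closed)"
      "sets (distr \<nu> borel (\<lambda>x. x)) = sigma_sets UNIV (Collect closed)"
      by (simp_all add: borel_eq_closed)
  qed auto
  show ?thesis
  proof (rule measure_eqI)
    show "sets \<mu> = sets \<nu>"
      using \<mu> \<nu> by (simp add: circle_measure_def)
    fix A assume A: "A \<in> sets \<mu>"
    then obtain B where B: "B \<in> sets borel" "A = B \<inter> sphere 0 1"
      using \<mu> by (auto simp: circle_measure_def sets_restrict_space)
    interpret m: finite_measure \<mu>
      using \<mu> by (simp add: circle_measure_def)
    interpret n: finite_measure \<nu>
      using \<nu> by (simp add: circle_measure_def)
    show "emeasure \<mu> A = emeasure \<nu> A"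
      using emeas[OF \<mu> B(1)] emeas[OF \<nu> B(1)] * B(2) by (simp add: m.emeasure_eq_measure n.emeasure_eq_measure)
  qed
qed

lemma poisson_integral_unique:
  assumes "circle_measure \<mu>" "circle_measure \<nu>"
    "\<And>z. z \<in> ball 0 1 \<Longrightarrow> (\<integral>\<zeta>. poisson z \<zeta> \<partial>\<mu>) = (\<integral>\<zeta>. poisson z \<zeta> \<partial>\<nu>)"
  shows "\<mu> = \<nu>"
  by (rule circle_measure_eqI[OF assms(1,2) continuous_integral_eq[OF assms(1,2) moments_eq_of_poisson_eq[OF assms]]])

section \<open>Existence of Clark measures\<close>

text \<open>Herglotz representation: the measures with density \<^term>\<open>\<lambda>t. Re (F (R * cis t))\<close> have a weakly convergent
  subsequence as \<^term>\<open>R\<close> tends to 1.\<close>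
lemma herglotz_representation:
  assumes F: "F holomorphic_on ball 0 1" and nonneg: "\<And>z. z \<in> ball 0 1 \<Longrightarrow> 0 \<le> Re (F z)"
    and pos: "0 < Re (F 0)"
  obtains \<mu> where "circle_measure \<mu>" "\<And>z. z \<in> ball 0 1 \<Longrightarrow> Re (F z) = (\<integral>\<zeta>. poisson z \<zeta> \<partial>\<mu>)"
proof -
  define c where "c = Re (F 0)"
  have c: "c > 0"
    using pos by (simp add: c_def)
  define R where "R n = real (Suc n) / real (Suc (Suc n))" for n
  have R: "0 < R n" "R n < 1" "1 < 1 / R n" for n
    by (auto simp: R_def)
  have Rlim: "R \<longlonglongrightarrow> 1"
    unfolding R_def by (rule LIMSEQ_Suc[OF LIMSEQ_n_over_Suc_n])
  have hol: "(\<lambda>z. F (of_real (R n) * z)) holomorphic_on ball 0 (1 / R n)" for n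
  proof -
    have "(F \<circ> (\<lambda>z. of_real (R n) * z)) holomorphic_on ball 0 (1 / R n)"
      using R[of n] by (intro holomorphic_on_compose_gen[OF _ F] holomorphic_intros)
        (auto simp: norm_mult field_simps)
    then show ?thesis
      by (simp add: o_def)
  qed
  \<comment> \<open>The circle is unrolled to an interval because Helly's theorem concerns
    distributions on the line. By the mean value property, dividing by \<open>2 * pi * c\<close>
    gives total mass 1.\<close>
  define v where "v n t = Re (F (of_real (R n) * cis t)) / (2 * pi * c)" for n t
  have v0: "0 \<le> v n t" for n t
    unfolding v_def using nonneg R[of n] c by (intro divide_nonneg_pos) (auto simp: norm_mult)
  have vc: "continuous_on UNIV (v n)" for n
  proof -
    have "continuous_on UNIV (\<lambda>t. F (of_real (R n) * cis t))"
      using R[of n]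
      by (intro continuous_on_compose2[OF holomorphic_on_imp_continuous_on[OF F]] continuous_intros)
         (auto simp: norm_mult)
    then show ?thesis
      unfolding v_def using c by (intro continuous_intros) auto
  qed
  define dens where "dens n t = indicator {0..2*pi} t * v n t" for n t
  have vm [measurable]: "v n \<in> borel_measurable borel" for n
    by (rule borel_measurable_continuous_onI[OF vc])
  have dm [measurable]: "dens n \<in> borel_measurable borel" for n
    unfolding dens_def by measurable
  have d0: "0 \<le> dens n t" for n t
    using v0 by (simp add: dens_def)
  define M where "M n = density lborel (\<lambda>t. ennreal (dens n t))" for n
  have int: "integrable lborel (\<lambda>t. dens n t * h t)" "(\<integral>t. dens n t * h t \<partial>lborel) = integral {0..2*pi} (\<lambda>t. v n t * h t)"
    if h: "continuous_on UNIV h" for n h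
  proof -
    have "continuous_on {0..2*pi} (\<lambda>t. v n t * h t)"
      by (intro continuous_intros continuous_on_subset[OF h] continuous_on_subset[OF vc]) auto
    from borel_integrable_atLeastAtMost'[OF this]
    have s: "set_integrable lborel {0..2*pi} (\<lambda>t. v n t * h t)" .
    then show "integrable lborel (\<lambda>t. dens n t * h t)"
      by (simp add: set_integrable_def dens_def mult.assoc)
    show "(\<integral>t. dens n t * h t \<partial>lborel) = integral {0..2*pi} (\<lambda>t. v n t * h t)"
      using set_borel_integral_eq_integral(2)[OF s] by (simp add: set_lebesgue_integral_def dens_def mult.assoc)
  qed
  have pois: "integral {0..2*pi} (\<lambda>t. v n t * poisson z (cis t)) = Re (F (of_real (R n) * z)) / c" if "z \<in> ball 0 1" for n z
  proof -
    have "((\<lambda>t. poisson z (cis t) * Re (F (of_real (R n) * cis t)) / (2 * pi * c)) has_integral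
        2 * pi * Re (F (of_real (R n) * z)) / (2 * pi * c)) {0..2*pi}"
      by (intro has_integral_divide poisson_formula_Re[OF hol R(3) that])
    then show ?thesis
      by (intro integral_unique) (simp add: v_def mult.commute)
  qed
  have total: "integral {0..2*pi} (\<lambda>t. v n t) = 1" for n
    using pois[of 0 n] c by (simp add: poisson_0 c_def)
  have mass: "(\<integral>\<^sup>+t. ennreal (dens n t) \<partial>lborel) = 1" for n
  proof -
    have "integrable lborel (dens n)" "(\<integral>t. dens n t \<partial>lborel) = 1"
      using int[of "\<lambda>_. 1" n] total[of n] by auto
    then show ?thesis
      using d0 by (subst nn_integral_eq_integral) auto
  qed
  have rd: "real_distribution (M n)" for n
  proof -
    have "prob_space (M n)"
      unfolding M_def by (rule prob_spaceI) (simp add: emeasure_density mass)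
    then show ?thesis
      by (simp add: real_distribution_def real_distribution_axioms_def M_def)
  qed
  \<comment> \<open>Tightness is stated with half-open intervals; a left end below 0 lets the
    interval contain all of \<open>{0..2*pi}\<close>, hence all the mass.\<close>
  have conc: "measure (M n) {-1<..2*pi} = 1" for n
  proof -
    have "emeasure (M n) {-1<..2*pi} = (\<integral>\<^sup>+t. ennreal (dens n t) * indicator {-1<..2*pi} t \<partial>lborel)"
      unfolding M_def by (simp add: emeasure_density)
    also have "\<dots> = (\<integral>\<^sup>+t. ennreal (dens n t) \<partial>lborel)"
      by (intro nn_integral_cong) (auto simp: dens_def indicator_def)
    finally show ?thesis
      by (simp add: mass measure_def)
  qed
  have "tight M"
    unfolding tight_def
  proof (intro conjI allI impI rd)
    fix e :: real assume "0 < e"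
    moreover have "-1 < 2 * pi"
      using pi_gt_zero by linarith
    ultimately show "\<exists>a b. a < b \<and> (\<forall>n. 1 - e < measure (M n) {a<..b})"
      by (intro exI[of _ "-1"] exI[of _ "2*pi"]) (simp add: conc)
  qed
  from tight_imp_convergent_subsubsequence[OF this strict_mono_id]
  obtain r \<nu> where r: "strict_mono r" and \<nu>: "real_distribution \<nu>" and conv: "weak_conv_m (\<lambda>n. M (r n)) \<nu>"
    by (auto simp: o_def id_def)
  interpret \<nu>: real_distribution \<nu>
    by fact
  \<comment> \<open>The Poisson integrals of the approximating measures have two limits: one by weak
    convergence, the other by continuity of F at z. The Poisson kernel is a bounded continuous test
    function because z is fixed.\<close>
  have key: "Re (F z) = c * (\<integral>t. poisson z (cis t) \<partial>\<nu>)" if z: "z \<in> ball 0 1" for z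
  proof -
    have ne: "cis t \<noteq> z" for t
      using z by auto
    have cP: "continuous_on UNIV (\<lambda>t. poisson z (cis t))"
      unfolding poisson_def using ne by (intro continuous_intros) auto
    have "(\<lambda>n. \<integral>t. poisson z (cis t) \<partial>M (r n)) \<longlonglongrightarrow> (\<integral>t. poisson z (cis t) \<partial>\<nu>)"
    proof (rule weak_conv_imp_integral_bdd_continuous_conv[OF rd \<nu> conv])
      show "isCont (\<lambda>t. poisson z (cis t)) t" for t
        using cP by (simp add: continuous_on_eq_continuous_at)
      show "norm (poisson z (cis t)) \<le> (1 + cmod z) / (1 - cmod z)" for t
        using poisson_bounds[of "cis t" z] z by simp
    qed
    moreover have "(\<integral>t. poisson z (cis t) \<partial>M n) = Re (F (of_real (R n) * z)) / c" for n
    proof -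
      have "(\<integral>t. poisson z (cis t) \<partial>M n) = (\<integral>t. dens n t *\<^sub>R poisson z (cis t) \<partial>lborel)"
        unfolding M_def using d0 borel_measurable_continuous_onI[OF cP] by (intro integral_density) auto
      also have "\<dots> = Re (F (of_real (R n) * z)) / c"
        using int(2)[OF cP, of n] pois[OF z] by simp
      finally show ?thesis .
    qed
    ultimately have l1: "(\<lambda>n. Re (F (of_real (R (r n)) * z)) / c) \<longlonglongrightarrow> (\<integral>t. poisson z (cis t) \<partial>\<nu>)"
      by simp
    have "isCont F z"
      using holomorphic_on_imp_continuous_on[OF F] z by (simp add: continuous_on_eq_continuous_at)
    moreover have "(\<lambda>n. of_real (R (r n)) * z) \<longlonglongrightarrow> of_real 1 * z"
      using LIMSEQ_subseq_LIMSEQ[OF Rlim r] by (intro tendsto_intros) (simp add: o_def)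
    ultimately have "(\<lambda>n. F (of_real (R (r n)) * z)) \<longlonglongrightarrow> F z"
      using isCont_tendsto_compose[of z F] by simp
    then have l2: "(\<lambda>n. Re (F (of_real (R (r n)) * z)) / c) \<longlonglongrightarrow> Re (F z) / c"
      using c by (intro tendsto_intros) auto
    show ?thesis
      using LIMSEQ_unique[OF l1 l2] c by simp
  qed
  \<comment> \<open>The limit is a probability measure on the line: the mass c is restored, then
    \<open>cis\<close> wraps the line onto the circle, adding any masses at 0 and
    \<open>2*pi\<close>.\<close>
  define N where "N = density \<nu> (\<lambda>_. ennreal c)"
  define \<mu> where "\<mu> = distr N (restrict_space borel (sphere 0 1)) cis"
  have "continuous_on UNIV cis"
    by (intro continuous_intros)
  then have "cis \<in> borel_measurable borel"
    by (rule borel_measurable_continuous_onI)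
  then have cm: "cis \<in> N \<rightarrow>\<^sub>M restrict_space borel (sphere 0 1)"
    by (intro measurable_restrict_space2) (auto simp: N_def measurable_def)
  have "finite_measure N"
    using \<nu>.emeasure_space_1
    by (intro finite_measureI) (auto simp: N_def emeasure_density nn_integral_cmult ennreal_mult_eq_top_iff)
  then have "finite_measure \<mu>"
    unfolding \<mu>_def by (rule finite_measure.finite_measure_distr[OF _ cm])
  then have \<mu>: "circle_measure \<mu>"
    by (simp add: circle_measure_def \<mu>_def)
  moreover have "Re (F z) = (\<integral>\<zeta>. poisson z \<zeta> \<partial>\<mu>)" if z: "z \<in> ball 0 1" for z
  proof -
    have "continuous_on (sphere 0 1) (poisson z)"
      unfolding poisson_def using z by (intro continuous_intros) auto
    then have m: "poisson z \<in> borel_measurable (restrict_space borel (sphere 0 1))"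
      by (rule borel_measurable_continuous_on_restrict)
    have mc: "(\<lambda>t. poisson z (cis t)) \<in> borel_measurable \<nu>"
      using measurable_compose[OF cm m] by (simp add: N_def)
    have "(\<integral>\<zeta>. poisson z \<zeta> \<partial>\<mu>) = (\<integral>t. poisson z (cis t) \<partial>N)"
      unfolding \<mu>_def by (rule integral_distr[OF cm m])
    also have "\<dots> = (\<integral>t. c *\<^sub>R poisson z (cis t) \<partial>\<nu>)"
      unfolding N_def using c mc by (intro integral_density) auto
    also have "\<dots> = Re (F z)"
      using key[OF z] by simp
    finally show ?thesis
      by simp
  qed
  ultimately show thesis
    by (rule that)
qed

text \<open>The definite description denotes: existence is the Herglotz representation of a function
  whose real part is a Poisson kernel at \<open>\<phi> z\<close>, and uniqueness is
  \<open>poisson_integral_unique\<close>. Everything later about \<open>clark_measure\<close> rests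
  on these facts.\<close>

lemma clark_measure_properties:
  assumes \<phi>: "analytic_selfmap \<phi>" and \<alpha>: "\<alpha> \<in> sphere 0 1"
  shows "circle_measure (clark_measure \<phi> \<alpha>)"
    and "\<And>z. z \<in> ball 0 1 \<Longrightarrow>
      Re ((\<alpha> + \<phi> z) / (\<alpha> - \<phi> z)) = (\<integral>\<zeta>. poisson z \<zeta> \<partial>clark_measure \<phi> \<alpha>)"
    and "(\<lambda>z. (\<alpha> + \<phi> z) / (\<alpha> - \<phi> z)) holomorphic_on ball 0 1"
proof -
  define F where "F z = (\<alpha> + \<phi> z) / (\<alpha> - \<phi> z)" for z
  have \<phi>h: "\<phi> holomorphic_on ball 0 1" and \<phi>b: "\<And>z. z \<in> ball 0 1 \<Longrightarrow> \<phi> z \<in> ball 0 1"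
    using \<phi> unfolding analytic_selfmap_def by blast+
  have \<alpha>1: "cmod \<alpha> = 1"
    using \<alpha> by simp
  have ne: "\<alpha> - \<phi> z \<noteq> 0" if "z \<in> ball 0 1" for z
    using \<phi>b[OF that] \<alpha>1 by auto
  then have F: "F holomorphic_on ball 0 1"
    unfolding F_def by (intro holomorphic_intros \<phi>h)
  then show "(\<lambda>z. (\<alpha> + \<phi> z) / (\<alpha> - \<phi> z)) holomorphic_on ball 0 1"
    by (simp add: F_def[abs_def])
  have ReF: "Re (F z) = poisson (\<phi> z) \<alpha>" if "z \<in> ball 0 1" for z
    unfolding F_def by (rule poisson_eq_Re[OF \<alpha>1 \<phi>b[OF that], symmetric])
  have F0: "0 \<le> Re (F z)" if "z \<in> ball 0 1" for z
    unfolding ReF[OF that] by (rule poisson_bounds(1)[OF \<alpha>1 \<phi>b[OF that]])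
  have "0 < poisson (\<phi> 0) \<alpha>"
    using ne[of 0] \<phi>b[of 0] unfolding poisson_def by (intro divide_pos_pos) (auto simp: abs_square_less_1)
  then have pos: "0 < Re (F 0)"
    by (simp add: ReF)
  let ?P = "\<lambda>\<mu>. sets \<mu> = sets (restrict_space borel (sphere 0 1)) \<and>
      space \<mu> = sphere 0 1 \<and> finite_measure \<mu> \<and>
      (\<forall>z\<in>ball 0 1. Re ((\<alpha> + \<phi> z) / (\<alpha> - \<phi> z)) = (\<integral>\<zeta>. poisson z \<zeta> \<partial>\<mu>))"
  obtain \<mu> where \<mu>: "circle_measure \<mu>" "\<And>z. z \<in> ball 0 1 \<Longrightarrow> Re (F z) = (\<integral>\<zeta>. poisson z \<zeta> \<partial>\<mu>)"
    using herglotz_representation[OF F F0 pos] by blast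
  have "?P (clark_measure \<phi> \<alpha>)"
    unfolding clark_measure_def
  proof (rule theI)
    show "?P \<mu>"
      using \<mu> space_circle_measure[OF \<mu>(1)] by (simp add: circle_measure_def F_def)
    fix \<nu> assume \<nu>: "?P \<nu>"
    show "\<nu> = \<mu>"
    proof (rule poisson_integral_unique[OF _ \<mu>(1)])
      show "circle_measure \<nu>"
        using \<nu> by (simp add: circle_measure_def)
      show "(\<integral>\<zeta>. poisson z \<zeta> \<partial>\<nu>) = (\<integral>\<zeta>. poisson z \<zeta> \<partial>\<mu>)" if "z \<in> ball 0 1" for z
        using \<nu> \<mu>(2)[OF that] that by (simp add: F_def)
    qed
  qed
  then show "circle_measure (clark_measure \<phi> \<alpha>)"
    and "\<And>z. z \<in> ball 0 1 \<Longrightarrow>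
      Re ((\<alpha> + \<phi> z) / (\<alpha> - \<phi> z)) = (\<integral>\<zeta>. poisson z \<zeta> \<partial>clark_measure \<phi> \<alpha>)"
    by (auto simp: circle_measure_def)
qed

section \<open>Atoms and kernels near the boundary\<close>

text \<open>The bound on \<epsilon> lets the quadratic term consume at most half of the linear one
  in \<open>1 - (cmod z)\<^sup>2\<close>. The last claim is the nontangential property: the distance
  to the circle stays comparable with \<epsilon>.\<close>

lemma nontangential_approach:
  fixes \<zeta> s :: complex and \<epsilon> :: real
  assumes \<zeta>: "cmod \<zeta> = 1" and \<epsilon>: "0 < \<epsilon>" "\<epsilon> * (cmod s)\<^sup>2 \<le> Re s"
  shows "1 - (cmod (\<zeta> * (1 - of_real \<epsilon> * s)))\<^sup>2 = \<epsilon> * (2 * Re s - \<epsilon> * (cmod s)\<^sup>2)"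
    and "0 < Re s \<Longrightarrow> \<zeta> * (1 - of_real \<epsilon> * s) \<in> ball 0 1"
    and "0 < Re s \<Longrightarrow> \<epsilon> * Re s / 2 \<le> 1 - cmod (\<zeta> * (1 - of_real \<epsilon> * s))"
proof -
  let ?z = "\<zeta> * (1 - of_real \<epsilon> * s)"
  have "cmod ?z = cmod (1 - of_real \<epsilon> * s)"
    using \<zeta> by (simp add: norm_mult)
  then have "(cmod ?z)\<^sup>2 = (1 - \<epsilon> * Re s)\<^sup>2 + (\<epsilon> * Im s)\<^sup>2"
    by (simp add: cmod_power2)
  then show eq: "1 - (cmod ?z)\<^sup>2 = \<epsilon> * (2 * Re s - \<epsilon> * (cmod s)\<^sup>2)"
    unfolding cmod_power2 by (simp add: power2_eq_square algebra_simps)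
  assume s: "0 < Re s"
  have "\<epsilon> * Re s \<le> 1 - (cmod ?z)\<^sup>2"
    unfolding eq using \<epsilon> by (intro mult_left_mono) auto
  moreover have "0 < \<epsilon> * Re s"
    using s \<epsilon> by simp
  ultimately have "(cmod ?z)\<^sup>2 < 1\<^sup>2"
    by simp
  then have z1: "cmod ?z < 1"
    by (rule power_less_imp_less_base) simp
  then show "?z \<in> ball 0 1"
    by simp
  have "1 - (cmod ?z)\<^sup>2 = (1 - cmod ?z) * (1 + cmod ?z)"
    by (simp add: power2_eq_square algebra_simps)
  also have "\<dots> \<le> (1 - cmod ?z) * 2"
    using z1 by (intro mult_left_mono) auto
  finally show "\<epsilon> * Re s / 2 \<le> 1 - cmod ?z"
    using \<open>\<epsilon> * Re s \<le> 1 - (cmod ?z)\<^sup>2\<close> by simp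
qed

lemma approach_tendsto:
  assumes "\<epsilon> \<longlonglongrightarrow> (0::real)"
  shows "(\<lambda>n. \<zeta> * (1 - of_real (\<epsilon> n) * s)) \<longlonglongrightarrow> (\<zeta> :: complex)"
proof -
  have "(\<lambda>n. \<zeta> * (1 - of_real (\<epsilon> n) * s)) \<longlonglongrightarrow> \<zeta> * (1 - of_real 0 * s)"
    by (intro tendsto_intros assms)
  then show ?thesis
    by simp
qed

text \<open>Multiplied by \<epsilon>, the Herglotz kernel tends to \<open>2 / s\<close> at the
  chosen point and to 0 at every other, so dominated convergence isolates the atom. The constant
  \<open>4 / Re s\<close> arises from a numerator of modulus at most 2 and a distance to the circle
  of at least \<open>\<epsilon> * Re s / 2\<close>.\<close>

lemma herglotz_atom_limit:
  assumes \<mu>: "circle_measure \<mu>" and \<zeta>: "cmod \<zeta>\<^sub>0 = 1" and s: "0 < Re s"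
    and \<epsilon>: "\<And>n. 0 < \<epsilon> n" "\<And>n. \<epsilon> n * (cmod s)\<^sup>2 \<le> Re s" "\<epsilon> \<longlonglongrightarrow> 0"
  shows "(\<lambda>n. of_real (\<epsilon> n) * herglotz \<mu> (\<zeta>\<^sub>0 * (1 - of_real (\<epsilon> n) * s)))
    \<longlonglongrightarrow> of_real (measure \<mu> {\<zeta>\<^sub>0}) * (2 / s)"
proof -
  interpret finite_measure \<mu>
    using \<mu> by (simp add: circle_measure_def)
  define z where "z n = \<zeta>\<^sub>0 * (1 - of_real (\<epsilon> n) * s)" for n
  have zb: "z n \<in> ball 0 1" for n
    unfolding z_def by (rule nontangential_approach(2)[OF \<zeta> \<epsilon>(1,2) s])
  have zlim: "z \<longlonglongrightarrow> \<zeta>\<^sub>0"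
    unfolding z_def by (rule approach_tendsto[OF \<epsilon>(3)])
  have s0: "s \<noteq> 0"
    using s by auto
  have sing: "{\<zeta>\<^sub>0} \<in> sets \<mu>"
  proof -
    have "{\<zeta>\<^sub>0} = sphere 0 1 \<inter> {\<zeta>\<^sub>0}"
      using \<zeta> by auto
    then show ?thesis
      using \<mu> by (auto simp: circle_measure_def sets_restrict_space)
  qed
  have "(\<lambda>n. \<integral>\<zeta>. of_real (\<epsilon> n) * ((\<zeta> + z n) / (\<zeta> - z n)) \<partial>\<mu>) \<longlonglongrightarrow> (\<integral>\<zeta>. indicator {\<zeta>\<^sub>0} \<zeta> *\<^sub>R (2 / s) \<partial>\<mu>)"
  proof (rule integral_dominated_convergence[where w = "\<lambda>_. 4 / Re s"])
    show "(\<lambda>\<zeta>. indicator {\<zeta>\<^sub>0} \<zeta> *\<^sub>R (2 / s)) \<in> borel_measurable \<mu>"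
      using sing by measurable
    show "(\<lambda>\<zeta>. of_real (\<epsilon> n) * ((\<zeta> + z n) / (\<zeta> - z n))) \<in> borel_measurable \<mu>" for n
      by (intro circle_measure_measurable[OF \<mu>] continuous_intros continuous_on_herglotz_kernel zb)
    show "AE \<zeta> in \<mu>. (\<lambda>n. of_real (\<epsilon> n) * ((\<zeta> + z n) / (\<zeta> - z n))) \<longlonglongrightarrow> indicator {\<zeta>\<^sub>0} \<zeta> *\<^sub>R (2 / s)"
    proof (rule AE_I2)
      fix \<zeta>
      show "(\<lambda>n. of_real (\<epsilon> n) * ((\<zeta> + z n) / (\<zeta> - z n))) \<longlonglongrightarrow> indicator {\<zeta>\<^sub>0} \<zeta> *\<^sub>R (2 / s)"
      proof (cases "\<zeta> = \<zeta>\<^sub>0")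
        case True
        have "of_real (\<epsilon> n) * ((\<zeta> + z n) / (\<zeta> - z n)) = (2 - of_real (\<epsilon> n) * s) / s" for n
        proof -
          have "\<zeta>\<^sub>0 \<noteq> 0"
            using \<zeta> by auto
          moreover have "\<zeta>\<^sub>0 + z n = \<zeta>\<^sub>0 * (2 - of_real (\<epsilon> n) * s)" "\<zeta>\<^sub>0 - z n = \<zeta>\<^sub>0 * (of_real (\<epsilon> n) * s)"
            by (simp_all add: z_def algebra_simps)
          ultimately show ?thesis
            using True \<epsilon>(1)[of n] s0 by simp
        qed
        moreover have "(\<lambda>n. (2 - of_real (\<epsilon> n) * s) / s) \<longlonglongrightarrow> (2 - of_real 0 * s) / s"
          using s0 by (intro tendsto_intros \<epsilon>(3)) auto
        ultimately show ?thesis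
          using True by simp
      next
        case False
        have "(\<lambda>n. of_real (\<epsilon> n) * ((\<zeta> + z n) / (\<zeta> - z n))) \<longlonglongrightarrow> of_real 0 * ((\<zeta> + \<zeta>\<^sub>0) / (\<zeta> - \<zeta>\<^sub>0))"
          using False by (intro tendsto_intros \<epsilon>(3) zlim) auto
        then show ?thesis
          using False by simp
      qed
    qed
    show "AE \<zeta> in \<mu>. norm (of_real (\<epsilon> n) * ((\<zeta> + z n) / (\<zeta> - z n))) \<le> 4 / Re s" for n
    proof (rule AE_I2)
      fix \<zeta> assume "\<zeta> \<in> space \<mu>"
      then have \<zeta>1: "cmod \<zeta> = 1"
        by (simp add: space_circle_measure[OF \<mu>])
      have "\<epsilon> n * Re s / 2 \<le> 1 - cmod (z n)"
        unfolding z_def by (rule nontangential_approach(3)[OF \<zeta> \<epsilon>(1,2) s])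
      also have "\<dots> \<le> cmod (\<zeta> - z n)"
        using norm_triangle_ineq2[of \<zeta> "z n"] \<zeta>1 by simp
      finally have low: "\<epsilon> n * Re s / 2 \<le> cmod (\<zeta> - z n)" .
      have up: "cmod (\<zeta> + z n) \<le> 2"
        using norm_triangle_ineq[of \<zeta> "z n"] \<zeta>1 zb[of n] by simp
      have p: "0 < \<epsilon> n * Re s / 2"
        using \<epsilon>(1)[of n] s by simp
      have "norm (of_real (\<epsilon> n) * ((\<zeta> + z n) / (\<zeta> - z n))) = \<epsilon> n * (cmod (\<zeta> + z n) / cmod (\<zeta> - z n))"
        using \<epsilon>(1)[of n] by (simp add: norm_mult norm_divide)
      also have "\<dots> \<le> \<epsilon> n * (2 / (\<epsilon> n * Re s / 2))"
        using low up p \<epsilon>(1)[of n] by (intro mult_left_mono frac_le) auto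
      also have "\<dots> = 4 / Re s"
        using \<epsilon>(1)[of n] s by (simp add: field_simps)
      finally show "norm (of_real (\<epsilon> n) * ((\<zeta> + z n) / (\<zeta> - z n))) \<le> 4 / Re s" .
    qed
  qed simp
  moreover have "(\<integral>\<zeta>. indicator {\<zeta>\<^sub>0} \<zeta> *\<^sub>R (2 / s) \<partial>\<mu>) = of_real (measure \<mu> {\<zeta>\<^sub>0}) * (2 / s)"
    using sing by (simp add: scaleR_conv_of_real)
  moreover have "(\<integral>\<zeta>. of_real (\<epsilon> n) * ((\<zeta> + z n) / (\<zeta> - z n)) \<partial>\<mu>) = of_real (\<epsilon> n) * herglotz \<mu> (z n)" for n
    unfolding herglotz_def by (rule integral_mult_right_zero)
  ultimately show ?thesis
    by (simp only: z_def)
qed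

text \<open>With F the quotient in the definition of the Clark measure,
  \<open>1 / (1 - cnj \<alpha> * \<phi> z)\<close> equals \<open>(F z + 1) / 2\<close>, and F
  differs from the Herglotz integral by a constant. The factor \<epsilon> removes both constants in
  the limit.\<close>

lemma clark_atom_limit:
  assumes \<phi>: "analytic_selfmap \<phi>" and \<alpha>: "\<alpha> \<in> sphere 0 1" and \<zeta>: "cmod \<zeta> = 1" and s: "0 < Re s"
    and \<epsilon>: "\<And>n. 0 < \<epsilon> n" "\<And>n. \<epsilon> n * (cmod s)\<^sup>2 \<le> Re s" "\<epsilon> \<longlonglongrightarrow> 0"
  shows "(\<lambda>n. of_real (\<epsilon> n) / (1 - cnj \<alpha> * \<phi> (\<zeta> * (1 - of_real (\<epsilon> n) * s))))
    \<longlonglongrightarrow> of_real (measure (clark_measure \<phi> \<alpha>) {\<zeta>}) / s"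
proof -
  define \<mu> where "\<mu> = clark_measure \<phi> \<alpha>"
  note cm = clark_measure_properties[OF \<phi> \<alpha>, folded \<mu>_def]
  define z where "z n = \<zeta> * (1 - of_real (\<epsilon> n) * s)" for n
  have zb: "z n \<in> ball 0 1" for n
    unfolding z_def by (rule nontangential_approach(2)[OF \<zeta> \<epsilon>(1,2) s])
  define F where "F z = (\<alpha> + \<phi> z) / (\<alpha> - \<phi> z)" for z
  define d where "d z = F z - herglotz \<mu> z" for z
  have "d holomorphic_on ball 0 1"
    unfolding d_def F_def by (intro holomorphic_on_diff cm(3) herglotz_holomorphic[OF cm(1)])
  moreover have "Re (d z) = 0" if "z \<in> ball 0 1" for z
    using cm(2)[OF that] Re_herglotz[OF cm(1) that] by (simp add: d_def F_def)
  ultimately have d: "d z = d 0" if "z \<in> ball 0 1" for z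
    using holomorphic_Re_zero_constant that by blast
  have "(\<lambda>n. (of_real (\<epsilon> n) * herglotz \<mu> (z n) + of_real (\<epsilon> n) * (d 0 + 1)) / 2)
      \<longlonglongrightarrow> (of_real (measure \<mu> {\<zeta>}) * (2 / s) + of_real 0 * (d 0 + 1)) / 2"
    unfolding z_def by (intro tendsto_intros herglotz_atom_limit[OF cm(1) \<zeta> s \<epsilon>] \<epsilon>(3)) auto
  moreover have "(of_real (\<epsilon> n) * herglotz \<mu> (z n) + of_real (\<epsilon> n) * (d 0 + 1)) / 2 =
      of_real (\<epsilon> n) / (1 - cnj \<alpha> * \<phi> (z n))" for n
  proof -
    have \<alpha>1: "cmod \<alpha> = 1"
      using \<alpha> by simp
    have "\<phi> (z n) \<in> ball 0 1"
      using \<phi> zb[of n] unfolding analytic_selfmap_def by blast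
    then have ne: "\<alpha> - \<phi> (z n) \<noteq> 0"
      using \<alpha>1 by auto
    have "\<alpha> * cnj \<alpha> = 1"
      using \<alpha>1 by (metis complex_norm_square of_real_1 one_power2)
    then have e: "\<alpha> * (1 - cnj \<alpha> * \<phi> (z n)) = \<alpha> - \<phi> (z n)"
      by (simp add: right_diff_distrib mult.assoc[symmetric])
    have "\<alpha> \<noteq> 0"
      using \<alpha>1 by auto
    then have "1 / (1 - cnj \<alpha> * \<phi> (z n)) = \<alpha> / (\<alpha> - \<phi> (z n))"
      using e by (metis mult_divide_mult_cancel_left mult.right_neutral)
    also have "\<dots> = (F (z n) + 1) / 2"
      using ne by (simp add: F_def field_simps)
    also have "F (z n) = herglotz \<mu> (z n) + d 0"
      unfolding d[OF zb[of n], symmetric] by (simp add: d_def)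
    finally have "1 / (1 - cnj \<alpha> * \<phi> (z n)) = (herglotz \<mu> (z n) + d 0 + 1) / 2" .
    then have "of_real (\<epsilon> n) * (1 / (1 - cnj \<alpha> * \<phi> (z n))) = of_real (\<epsilon> n) * ((herglotz \<mu> (z n) + d 0 + 1) / 2)"
      by (simp only:)
    then show ?thesis
      by (simp add: algebra_simps)
  qed
  moreover have "(of_real (measure \<mu> {\<zeta>}) * (2 / s) + of_real 0 * (d 0 + 1)) / 2 = of_real (measure \<mu> {\<zeta>}) / s"
    by simp
  ultimately show ?thesis
    by (simp only: z_def \<mu>_def)
qed

text \<open>With \<open>x = cnj \<alpha> * \<phi> z\<close>, the denominator
  \<open>1 - cnj w * \<phi> z\<close> is
  \<open>(1 - x) * (1 - \<epsilon> * cnj s) + \<epsilon> * cnj s\<close>, so everything is a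
  function of \<open>y = \<epsilon> / (1 - x)\<close>, whose limit is known. Using y and not its
  reciprocal covers b = 0 as well. In the application a is always the mass for \<phi>, while b is
  the mass for either map.\<close>

lemma kernel_pairing_limit:
  assumes \<phi>: "analytic_selfmap \<phi>" and \<alpha>: "\<alpha> \<in> sphere 0 1" and \<zeta>: "cmod \<zeta> = 1"
    and a: "0 < a" and s: "Re s = 1"
    and \<epsilon>: "\<And>n. 0 < \<epsilon> n" "\<And>n. \<epsilon> n * (cmod s)\<^sup>2 \<le> 1" "\<And>n. \<epsilon> n * (a * (cmod s)\<^sup>2) \<le> 1" "\<epsilon> \<longlonglongrightarrow> 0"
  defines "b \<equiv> measure (clark_measure \<phi> \<alpha>) {\<zeta>}"
  defines "z \<equiv> \<lambda>n. \<zeta> * (1 - of_real (\<epsilon> n) * (of_real a * s))"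
    and "w \<equiv> \<lambda>n. \<alpha> * (1 - of_real (\<epsilon> n) * s)"
  shows "(\<lambda>n. of_real (sqrt (1 - (cmod (z n))\<^sup>2)) * h2_kernel (w n) (\<phi> (z n)))
    \<longlonglongrightarrow> of_real (2 * sqrt a * b) / (of_real a * s + of_real b * cnj s)"
proof -
  have \<alpha>1: "cmod \<alpha> = 1"
    using \<alpha> by simp
  have s': "0 < Re (of_real a * s)" "0 < Re s"
    using a s by auto
  have ns: "(cmod (of_real a * s))\<^sup>2 = a * (a * (cmod s)\<^sup>2)"
    using a by (simp add: norm_mult power_mult_distrib power2_eq_square)
  have \<epsilon>': "\<epsilon> n * (cmod (of_real a * s))\<^sup>2 \<le> Re (of_real a * s)" "\<epsilon> n * (cmod s)\<^sup>2 \<le> Re s" for n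
    using \<epsilon>(2)[of n] mult_left_mono[OF \<epsilon>(3)[of n], of a] a s unfolding ns by (auto simp: mult_ac)
  have b0: "0 \<le> b"
    by (simp add: b_def)
  define x where "x n = cnj \<alpha> * \<phi> (z n)" for n
  define y where "y n = of_real (\<epsilon> n) / (1 - x n)" for n
  have ylim: "y \<longlonglongrightarrow> of_real b / (of_real a * s)"
    unfolding y_def x_def z_def b_def by (rule clark_atom_limit[OF \<phi> \<alpha> \<zeta> s'(1) \<epsilon>(1) \<epsilon>'(1) \<epsilon>(4)])
  have x1: "1 - x n \<noteq> 0" for n
  proof -
    have "z n \<in> ball 0 1"
      unfolding z_def by (rule nontangential_approach(2)[OF \<zeta> \<epsilon>(1) \<epsilon>'(1) s'(1)])
    then have "\<phi> (z n) \<in> ball 0 1"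
      using \<phi> unfolding analytic_selfmap_def by blast
    then have "cmod (x n) < 1"
      using \<alpha>1 by (simp add: x_def norm_mult)
    then show ?thesis
      by auto
  qed
  have as0: "of_real a * s \<noteq> 0" "s \<noteq> 0"
    using s'(1) by auto
  have "Re (of_real a * s + of_real b * cnj s) > 0"
    using a b0 s by simp
  then have den: "of_real a * s + of_real b * cnj s \<noteq> 0"
    by (metis less_irrefl zero_complex.simps(1))
  have den': "1 + cnj s * (of_real b / (of_real a * s)) = (of_real a * s + of_real b * cnj s) / (of_real a * s)"
    using as0 a by (simp add: field_simps)
  have "(\<lambda>n. y n / ((1 - of_real (\<epsilon> n) * cnj s) + cnj s * y n)) \<longlonglongrightarrow>
      (of_real b / (of_real a * s)) / ((1 - of_real 0 * cnj s) + cnj s * (of_real b / (of_real a * s)))"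
    using den den' as0 by (intro tendsto_intros ylim \<epsilon>(4)) auto
  moreover have "(of_real b / (of_real a * s)) / ((1 - of_real 0 * cnj s) + cnj s * (of_real b / (of_real a * s)))
      = of_real b / (of_real a * s + of_real b * cnj s)"
    using as0 den a unfolding of_real_0 mult_zero_left diff_zero den' by simp
  moreover have "y n / ((1 - of_real (\<epsilon> n) * cnj s) + cnj s * y n) = of_real (\<epsilon> n) / (1 - cnj (w n) * \<phi> (z n))" for n
  proof -
    have "cnj (w n) * \<phi> (z n) = x n * (1 - of_real (\<epsilon> n) * cnj s)"
      by (simp add: w_def x_def)
    then have "1 - cnj (w n) * \<phi> (z n) = (1 - x n) * (1 - of_real (\<epsilon> n) * cnj s) + cnj s * of_real (\<epsilon> n)"
      by (simp add: algebra_simps)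
    also have "cnj s * of_real (\<epsilon> n) = (1 - x n) * (cnj s * y n)"
      using x1[of n] by (simp add: y_def)
    finally have "1 - cnj (w n) * \<phi> (z n) = (1 - x n) * ((1 - of_real (\<epsilon> n) * cnj s) + cnj s * y n)"
      by (simp only: distrib_left)
    then show ?thesis
      using x1[of n] by (simp add: y_def)
  qed
  ultimately have l1: "(\<lambda>n. of_real (\<epsilon> n) / (1 - cnj (w n) * \<phi> (z n))) \<longlonglongrightarrow> of_real b / (of_real a * s + of_real b * cnj s)"
    by (simp only:)
  have zz: "1 - (cmod (z n))\<^sup>2 = \<epsilon> n * (2 * a - \<epsilon> n * (cmod (of_real a * s))\<^sup>2)" for n
    unfolding z_def using nontangential_approach(1)[OF \<zeta> \<epsilon>(1) \<epsilon>'(1)] s by simp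
  have ww: "1 - (cmod (w n))\<^sup>2 = \<epsilon> n * (2 - \<epsilon> n * (cmod s)\<^sup>2)" for n
    unfolding w_def using nontangential_approach(1)[OF \<alpha>1 \<epsilon>(1) \<epsilon>'(2)] s by simp
  have "(\<lambda>n. of_real (sqrt (2 * a - \<epsilon> n * (cmod (of_real a * s))\<^sup>2) * sqrt (2 - \<epsilon> n * (cmod s)\<^sup>2)) *
      (of_real (\<epsilon> n) / (1 - cnj (w n) * \<phi> (z n)))) \<longlonglongrightarrow>
      of_real (sqrt (2 * a - 0 * (cmod (of_real a * s))\<^sup>2) * sqrt (2 - 0 * (cmod s)\<^sup>2)) *
      (of_real b / (of_real a * s + of_real b * cnj s))"
    by (intro tendsto_intros l1 \<epsilon>(4))
  moreover have "of_real (sqrt (2 * a - 0 * (cmod (of_real a * s))\<^sup>2) * sqrt (2 - 0 * (cmod s)\<^sup>2)) *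
      (of_real b / (of_real a * s + of_real b * cnj s)) = of_real (2 * sqrt a * b) / (of_real a * s + of_real b * cnj s)"
  proof -
    have "sqrt (2 * a - 0 * (cmod (of_real a * s))\<^sup>2) * sqrt (2 - 0 * (cmod s)\<^sup>2) = 2 * sqrt a"
      by (simp add: real_sqrt_mult)
    then show ?thesis
      by (simp only: of_real_mult times_divide_eq_right)
  qed
  moreover have "of_real (sqrt (2 * a - \<epsilon> n * (cmod (of_real a * s))\<^sup>2) * sqrt (2 - \<epsilon> n * (cmod s)\<^sup>2)) *
      (of_real (\<epsilon> n) / (1 - cnj (w n) * \<phi> (z n))) =
      of_real (sqrt (1 - (cmod (z n))\<^sup>2)) * h2_kernel (w n) (\<phi> (z n))" for n
  proof -
    \<comment> \<open>Each normalising square root contributes \<open>sqrt (\<epsilon> n)\<close>;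
      together they supply the factor \<open>\<epsilon> n\<close> present in
      \<open>l1\<close>.\<close>
    have "sqrt (1 - (cmod (z n))\<^sup>2) * sqrt (1 - (cmod (w n))\<^sup>2) =
        sqrt (2 * a - \<epsilon> n * (cmod (of_real a * s))\<^sup>2) * sqrt (2 - \<epsilon> n * (cmod s)\<^sup>2) * (sqrt (\<epsilon> n) * sqrt (\<epsilon> n))"
      unfolding zz ww by (simp add: real_sqrt_mult)
    also have "sqrt (\<epsilon> n) * sqrt (\<epsilon> n) = \<epsilon> n"
      using \<epsilon>(1)[of n] by simp
    finally have "complex_of_real (sqrt (1 - (cmod (z n))\<^sup>2) * sqrt (1 - (cmod (w n))\<^sup>2)) =
        of_real (sqrt (2 * a - \<epsilon> n * (cmod (of_real a * s))\<^sup>2) * sqrt (2 - \<epsilon> n * (cmod s)\<^sup>2) * \<epsilon> n)"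
      by (simp only:)
    then show ?thesis
      by (simp add: h2_kernel_def)
  qed
  ultimately show ?thesis
    by (simp only:)
qed

text \<open>Diagonal entries are exactly the squared weights. Off the diagonal the numerators tend
  to 0, while the denominators tend to \<open>1 - i * cnj j\<close>, which is nonzero for distinct
  points of the circle.\<close>

lemma gram_limit:
  fixes z :: "complex \<Rightarrow> nat \<Rightarrow> complex" and c :: "complex \<Rightarrow> real"
  assumes F: "F \<subseteq> sphere 0 1" "finite F"
    and z: "\<And>\<zeta> n. \<zeta> \<in> F \<Longrightarrow> z \<zeta> n \<in> ball 0 1" "\<And>\<zeta>. \<zeta> \<in> F \<Longrightarrow> z \<zeta> \<longlonglongrightarrow> \<zeta>"
  defines "d \<equiv> \<lambda>\<zeta> n. complex_of_real (c \<zeta> * sqrt (1 - (cmod (z \<zeta> n))\<^sup>2))"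
  shows "(\<lambda>n. Re (\<Sum>i\<in>F. \<Sum>j\<in>F. d i n * cnj (d j n) / (1 - z i n * cnj (z j n)))) \<longlonglongrightarrow> (\<Sum>\<zeta>\<in>F. (c \<zeta>)\<^sup>2)"
proof -
  have dlim: "d i \<longlonglongrightarrow> 0" if "i \<in> F" for i
  proof -
    have "cmod i = 1"
      using that F by auto
    moreover have "d i \<longlonglongrightarrow> of_real (c i * sqrt (1 - (cmod i)\<^sup>2))"
      unfolding d_def by (intro tendsto_intros z(2) that)
    ultimately show ?thesis
      by simp
  qed
  have "(\<lambda>n. d i n * cnj (d j n) / (1 - z i n * cnj (z j n))) \<longlonglongrightarrow> (if i = j then of_real ((c i)\<^sup>2) else 0)"
    if ij: "i \<in> F" "j \<in> F" for i j
  proof (cases "i = j")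
    case True
    have "d i n * cnj (d i n) / (1 - z i n * cnj (z i n)) = of_real ((c i)\<^sup>2)" for n
    proof -
      have "cmod (z i n) < 1"
        using z(1)[OF ij(1), of n] by simp
      then have p: "1 - (cmod (z i n))\<^sup>2 > 0"
        by (simp add: abs_square_less_1)
      have "d i n * cnj (d i n) = of_real ((c i * sqrt (1 - (cmod (z i n))\<^sup>2))\<^sup>2)"
        by (simp add: d_def power2_eq_square)
      also have "(c i * sqrt (1 - (cmod (z i n))\<^sup>2))\<^sup>2 = (c i)\<^sup>2 * (1 - (cmod (z i n))\<^sup>2)"
        using p by (simp add: power_mult_distrib)
      finally have e: "d i n * cnj (d i n) = of_real ((c i)\<^sup>2) * of_real (1 - (cmod (z i n))\<^sup>2)"
        by (simp only: of_real_mult)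
      have "1 - z i n * cnj (z i n) = of_real (1 - (cmod (z i n))\<^sup>2)"
        by (simp add: complex_norm_square del: of_real_power)
      then show ?thesis
        unfolding e using p by (metis less_irrefl nonzero_mult_div_cancel_right of_real_eq_0_iff)
    qed
    then show ?thesis
      using True by simp
  next
    case False
    have "cmod i = 1" "cmod j = 1"
      using ij F by auto
    then have "j * cnj j = 1"
      by (metis complex_norm_square of_real_1 one_power2)
    then have ne: "1 - i * cnj j \<noteq> 0"
      using False by (metis eq_iff_diff_eq_0 mult_cancel_right mult_zero_right zero_neq_one)
    have "(\<lambda>n. d i n * cnj (d j n) / (1 - z i n * cnj (z j n))) \<longlonglongrightarrow> 0 * cnj 0 / (1 - i * cnj j)"
      by (intro tendsto_intros dlim z(2) ij ne)
    then show ?thesis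
      using False by simp
  qed
  then have "(\<lambda>n. Re (\<Sum>i\<in>F. \<Sum>j\<in>F. d i n * cnj (d j n) / (1 - z i n * cnj (z j n)))) \<longlonglongrightarrow>
      Re (\<Sum>i\<in>F. \<Sum>j\<in>F. (if i = j then of_real ((c i)\<^sup>2) else 0))"
    by (intro tendsto_intros)
  moreover have "Re (\<Sum>i\<in>F. \<Sum>j\<in>F. (if i = j then of_real ((c i)\<^sup>2) else 0)) = (\<Sum>\<zeta>\<in>F. (c \<zeta>)\<^sup>2)"
    using F(2) by (simp add: sum.delta if_distrib[of Re] cong: if_cong)
  ultimately show ?thesis
    by simp
qed

section \<open>Compact operators and finiteness of the operator norm\<close>

lemma compact_op_cauchy_subsequence:
  assumes "compact_op K" "\<And>n::nat. F n \<in> H2" "\<And>n. h2_norm (F n) \<le> 1"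
  shows "\<exists>r::nat \<Rightarrow> nat. strict_mono r \<and>
      (\<forall>e::real>0. \<exists>N::nat. \<forall>m\<ge>N. \<forall>n\<ge>N. h2_norm (\<lambda>z. K (F (r m)) z - K (F (r n)) z) < e)"
  using assms(1)[unfolded compact_op_def, THEN conjunct2, THEN conjunct2, rule_format, of F] assms(2,3) by simp

text \<open>Boundedness is a consequence of sequential compactness: if \<open>K (F n)\<close> had
  norm above n on the unit ball, no subsequence of the images could be Cauchy.\<close>

lemma compact_op_bounded:
  assumes K: "compact_op K"
  obtains B where "\<And>f. f \<in> H2 \<Longrightarrow> h2_norm f \<le> 1 \<Longrightarrow> h2_norm (K f) \<le> B"
proof (rule ccontr)
  assume "\<not> thesis"
  then have "\<forall>n::nat. \<exists>f. f \<in> H2 \<and> h2_norm f \<le> 1 \<and> real n < h2_norm (K f)"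
    using that by (meson not_less)
  then obtain F where F: "\<And>n. F n \<in> H2 \<and> h2_norm (F n) \<le> 1" "\<And>n. real n < h2_norm (K (F n))"
    by metis
  obtain r :: "nat \<Rightarrow> nat" where r: "strict_mono r"
    and c: "\<forall>e::real>0. \<exists>N. \<forall>m\<ge>N. \<forall>n\<ge>N. h2_norm (\<lambda>z. K (F (r m)) z - K (F (r n)) z) < e"
    using compact_op_cauchy_subsequence[of K F, OF K conjunct1[OF F(1)] conjunct2[OF F(1)]] by blast
  obtain N where N: "\<And>m n. m \<ge> N \<Longrightarrow> n \<ge> N \<Longrightarrow> h2_norm (\<lambda>z. K (F (r m)) z - K (F (r n)) z) < 1"
    using c[rule_format, of 1] by auto
  have KH: "K (F n) \<in> H2" for n
    using K F(1) unfolding compact_op_def by blast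
  obtain k :: nat where k: "1 + h2_norm (K (F (r N))) \<le> real k"
    using real_arch_simple by blast
  define n where "n = max N k"
  have sub: "K (F (r N)) z - (K (F (r N)) z - K (F (r n)) z) = K (F (r n)) z" for z
    by simp
  have "h2_norm (K (F (r n))) = h2_norm (\<lambda>z. K (F (r N)) z - (K (F (r N)) z - K (F (r n)) z))"
    by (simp only: sub)
  also have "\<dots> \<le> h2_norm (K (F (r N))) + h2_norm (\<lambda>z. K (F (r N)) z - K (F (r n)) z)"
    by (intro H2_diff KH)
  also have "\<dots> \<le> h2_norm (K (F (r N))) + 1"
    using N[of N n] by (simp add: n_def less_imp_le)
  also have "\<dots> \<le> real k"
    using k by simp
  also have "\<dots> \<le> real (r n)"
    using seq_suble[OF r, of n] by (simp add: n_def)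
  also have "\<dots> < h2_norm (K (F (r n)))"
    by (rule F(2))
  finally show False
    by simp
qed

text \<open>Ensures that the infimum in \<open>ess_norm\<close> ranges over a nonempty set.\<close>

lemma compact_op_zero: "compact_op (\<lambda>f z. 0)"
  unfolding compact_op_def by (auto simp: H2_zero intro!: exI[of _ id] strict_mono_id)

text \<open>The supremum defining \<open>op_norm\<close> is an upper bound only because the set is
  bounded above, which Littlewood subordination gives for both composition operators and
  \<open>compact_op_bounded\<close> for K.\<close>

lemma h2_norm_le_op_norm:
  assumes \<phi>: "analytic_selfmap \<phi>" and \<psi>: "analytic_selfmap \<psi>" and K: "compact_op K"
    and f: "f \<in> H2" "h2_norm f \<le> 1"
  defines "D \<equiv> \<lambda>f z. comp_op \<phi> f z - comp_op \<psi> f z - K f z"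
  shows "D f \<in> H2" "h2_norm (D f) \<le> op_norm D"
proof -
  obtain B where B: "\<And>f. f \<in> H2 \<Longrightarrow> h2_norm f \<le> 1 \<Longrightarrow> h2_norm (K f) \<le> B"
    using compact_op_bounded[OF K] by blast
  define C where "C \<theta> = sqrt ((1 + cmod (\<theta> 0)) / (1 - cmod (\<theta> 0)))" for \<theta> :: "complex \<Rightarrow> complex"
  have C: "h2_norm (comp_op \<theta> f) \<le> C \<theta>" if "analytic_selfmap \<theta>" "f \<in> H2" "h2_norm f \<le> 1" for \<theta> f
  proof -
    have "\<theta> 0 \<in> ball 0 1"
      using that(1) unfolding analytic_selfmap_def by (simp add: image_subset_iff)
    then have "0 \<le> C \<theta>"
      by (simp add: C_def)
    then have "C \<theta> * h2_norm f \<le> C \<theta> * 1"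
      using that(3) by (rule mult_left_mono[rotated])
    then show ?thesis
      using composition_bounded(2)[OF that(1,2)] by (simp add: comp_op_def C_def)
  qed
  have H: "comp_op \<phi> f \<in> H2" "comp_op \<psi> f \<in> H2" "K f \<in> H2" if "f \<in> H2" for f
    using that composition_bounded(1) \<phi> \<psi> K by (auto simp: comp_op_def compact_op_def)
  show "D f \<in> H2"
    unfolding D_def by (intro H2_diff H f)
  have "h2_norm (D g) \<le> C \<phi> + C \<psi> + B" if "g \<in> H2" "h2_norm g \<le> 1" for g
  proof -
    have "h2_norm (D g) \<le> h2_norm (\<lambda>z. comp_op \<phi> g z - comp_op \<psi> g z) + h2_norm (K g)"
      unfolding D_def by (intro H2_diff H that)
    also have "h2_norm (\<lambda>z. comp_op \<phi> g z - comp_op \<psi> g z) \<le> h2_norm (comp_op \<phi> g) + h2_norm (comp_op \<psi> g)"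
      by (intro H2_diff H that)
    finally show ?thesis
      using C[OF \<phi> that] C[OF \<psi> that] B[OF that] by simp
  qed
  then show "h2_norm (D f) \<le> op_norm D"
    unfolding op_norm_def using f by (intro cSUP_upper bdd_aboveI2[of _ _ "C \<phi> + C \<psi> + B"]) auto
qed

section \<open>The lower bound\<close>

text \<open>Only the functionals need to tend weakly to 0. Along a subsequence
  \<open>K (f n)\<close> stays within e of one fixed member, on which the functionals vanish in the
  limit by boundary decay. Their norms tend to 1, so the compact term costs at most e.\<close>

lemma pairing_le_op_norm:
  assumes \<phi>: "analytic_selfmap \<phi>" and \<psi>: "analytic_selfmap \<psi>" and K: "compact_op K"
    and f: "\<And>n. f n \<in> H2" "\<And>n. h2_norm (f n) \<le> 1"
    and F: "F \<subseteq> sphere 0 1" "finite F"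
    and z: "\<And>\<zeta> n. \<zeta> \<in> F \<Longrightarrow> z \<zeta> n \<in> ball 0 1" "\<And>\<zeta>. \<zeta> \<in> F \<Longrightarrow> z \<zeta> \<longlonglongrightarrow> \<zeta>"
    and c: "(\<Sum>\<zeta>\<in>F. (c \<zeta>)\<^sup>2) = 1"
    and lim: "(\<lambda>n. \<Sum>\<zeta>\<in>F. complex_of_real (c \<zeta> * sqrt (1 - (cmod (z \<zeta> n))\<^sup>2)) *
      (f n (\<phi> (z \<zeta> n)) - f n (\<psi> (z \<zeta> n)))) \<longlonglongrightarrow> L"
  shows "cmod L \<le> op_norm (\<lambda>f z. comp_op \<phi> f z - comp_op \<psi> f z - K f z)"
proof (rule field_le_epsilon)
  fix e :: real assume e: "e > 0"
  define D where "D = (\<lambda>f z. comp_op \<phi> f z - comp_op \<psi> f z - K f z)"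
  have DH: "D (f n) \<in> H2" and Dn: "h2_norm (D (f n)) \<le> op_norm D" for n
    unfolding D_def by (rule h2_norm_le_op_norm[OF \<phi> \<psi> K f])+
  have KH: "K (f n) \<in> H2" for n
    using K f(1) unfolding compact_op_def by blast
  define d where "d \<zeta> n = complex_of_real (c \<zeta> * sqrt (1 - (cmod (z \<zeta> n))\<^sup>2))" for \<zeta> n
  define \<Lambda> where "\<Lambda> n h = (\<Sum>\<zeta>\<in>F. d \<zeta> n * h (z \<zeta> n))" for n and h :: "complex \<Rightarrow> complex"
  define G where "G n = sqrt (Re (\<Sum>i\<in>F. \<Sum>j\<in>F. d i n * cnj (d j n) / (1 - z i n * cnj (z j n))))" for n
  have \<Lambda>: "cmod (\<Lambda> n h) \<le> h2_norm h * G n" if "h \<in> H2" for n h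
    unfolding \<Lambda>_def G_def by (rule H2_evaluation_bound[OF that F(2) z(1)])
  have "G \<longlonglongrightarrow> sqrt (\<Sum>\<zeta>\<in>F. (c \<zeta>)\<^sup>2)"
    unfolding G_def d_def by (intro tendsto_intros gram_limit F z)
  then have Glim: "G \<longlonglongrightarrow> 1"
    by (simp add: c)
  \<comment> \<open>\<open>sqrt\<close> is negative at negative arguments, so the sign needs a
    reason. A negative value would contradict the evaluation bound for \<open>h2_kernel 0\<close>,
    which is the constant function 1.\<close>
  have G0: "0 \<le> G n" for n
  proof (rule ccontr)
    assume "\<not> 0 \<le> G n"
    moreover define h where "h = h2_kernel 0"
    have h: "h \<in> H2"
      unfolding h_def by (rule h2_kernel_H2) simp
    moreover have "1 \<le> h2_norm h"
      using H2_pointwise_bound[OF h, of 0] by (simp add: h_def h2_kernel_def)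
    ultimately have "h2_norm h * G n < 0"
      by (intro mult_pos_neg) auto
    then show False
      using \<Lambda>[OF h, of n] by (meson norm_ge_zero not_less order_trans)
  qed
  obtain r :: "nat \<Rightarrow> nat" where r: "strict_mono r"
    and ca: "\<forall>e::real>0. \<exists>N. \<forall>m\<ge>N. \<forall>n\<ge>N. h2_norm (\<lambda>z. K (f (r m)) z - K (f (r n)) z) < e"
    using compact_op_cauchy_subsequence[of K f, OF K f] by blast
  obtain N where N: "\<And>m n. m \<ge> N \<Longrightarrow> n \<ge> N \<Longrightarrow> h2_norm (\<lambda>z. K (f (r m)) z - K (f (r n)) z) < e"
    using ca[rule_format, OF e] by blast
  have decay: "(\<lambda>n. \<Lambda> n (K (f (r N)))) \<longlonglongrightarrow> 0"
  proof -
    have "(\<lambda>n. complex_of_real (c \<zeta>) * (of_real (sqrt (1 - (cmod (z \<zeta> n))\<^sup>2)) * K (f (r N)) (z \<zeta> n)))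
        \<longlonglongrightarrow> complex_of_real (c \<zeta>) * 0" if "\<zeta> \<in> F" for \<zeta>
    proof (intro tendsto_intros H2_boundary_decay KH z(1) that)
      have "(\<lambda>n. cmod (z \<zeta> n)) \<longlonglongrightarrow> cmod \<zeta>"
        by (intro tendsto_intros z(2) that)
      then show "(\<lambda>n. cmod (z \<zeta> n)) \<longlonglongrightarrow> 1"
        using F that by auto
    qed
    then have "(\<lambda>n. \<Sum>\<zeta>\<in>F. complex_of_real (c \<zeta>) * (of_real (sqrt (1 - (cmod (z \<zeta> n))\<^sup>2)) * K (f (r N)) (z \<zeta> n)))
        \<longlonglongrightarrow> (\<Sum>\<zeta>\<in>F. complex_of_real (c \<zeta>) * 0)"
      by (intro tendsto_sum)
    then show ?thesis
      by (simp add: \<Lambda>_def d_def mult.assoc)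
  qed
  have bound: "cmod (\<Lambda> (r n) (\<lambda>u. f (r n) (\<phi> u) - f (r n) (\<psi> u))) \<le>
      op_norm D * G (r n) + e * G (r n) + cmod (\<Lambda> (r n) (K (f (r N))))" if n: "n \<ge> N" for n
  proof -
    let ?k = "\<lambda>u. K (f (r n)) u - K (f (r N)) u"
    have eq: "\<Lambda> (r n) (\<lambda>u. f (r n) (\<phi> u) - f (r n) (\<psi> u)) =
        \<Lambda> (r n) (D (f (r n))) + \<Lambda> (r n) ?k + \<Lambda> (r n) (K (f (r N)))"
      unfolding \<Lambda>_def D_def comp_op_def o_def
      by (simp add: sum.distrib[symmetric] distrib_left[symmetric])
    have "cmod (\<Lambda> (r n) (\<lambda>u. f (r n) (\<phi> u) - f (r n) (\<psi> u))) \<le>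
        cmod (\<Lambda> (r n) (D (f (r n)))) + cmod (\<Lambda> (r n) ?k) + cmod (\<Lambda> (r n) (K (f (r N))))"
      unfolding eq using norm_triangle_ineq[of "\<Lambda> (r n) (D (f (r n)))" "\<Lambda> (r n) ?k"]
        norm_triangle_ineq[of "\<Lambda> (r n) (D (f (r n))) + \<Lambda> (r n) ?k" "\<Lambda> (r n) (K (f (r N)))"] by linarith
    moreover have "cmod (\<Lambda> (r n) (D (f (r n)))) \<le> op_norm D * G (r n)"
      by (rule order_trans[OF \<Lambda>[OF DH]]) (rule mult_right_mono[OF Dn G0])
    moreover have "cmod (\<Lambda> (r n) ?k) \<le> e * G (r n)"
      by (rule order_trans[OF \<Lambda>[OF H2_diff(1)[OF KH KH]]])
        (rule mult_right_mono[OF less_imp_le[OF N[OF n order_refl]] G0])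
    ultimately show ?thesis
      by linarith
  qed
  have Gr: "(\<lambda>n. G (r n)) \<longlonglongrightarrow> 1"
    using LIMSEQ_subseq_LIMSEQ[OF Glim r] by (simp add: o_def)
  have dr: "(\<lambda>n. \<Lambda> (r n) (K (f (r N)))) \<longlonglongrightarrow> 0"
    using LIMSEQ_subseq_LIMSEQ[OF decay r] by (simp add: o_def)
  have lr: "(\<lambda>n. \<Lambda> (r n) (\<lambda>u. f (r n) (\<phi> u) - f (r n) (\<psi> u))) \<longlonglongrightarrow> L"
    using LIMSEQ_subseq_LIMSEQ[OF lim r] by (simp add: o_def \<Lambda>_def d_def)
  have "(\<lambda>n. op_norm D * G (r n) + e * G (r n) + cmod (\<Lambda> (r n) (K (f (r N))))) \<longlonglongrightarrow> op_norm D * 1 + e * 1 + cmod 0"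
    by (intro tendsto_intros Gr dr)
  from LIMSEQ_le[OF tendsto_norm[OF lr] this] have "cmod L \<le> op_norm D * 1 + e * 1 + cmod 0"
    using bound by blast
  then show "cmod L \<le> op_norm (\<lambda>f z. comp_op \<phi> f z - comp_op \<psi> f z - K f z) + e"
    by (simp add: D_def)
qed

text \<open>The kernels are taken at points approaching \<^term>\<open>\<alpha>\<close> along the ray of slope \<^term>\<open>M\<close>. As \<^term>\<open>M\<close> grows, the
  contribution of \<^term>\<open>\<psi>\<close> at an atom vanishes, because its mass differs from that of \<^term>\<open>\<phi>\<close>.\<close>
lemma finite_atoms_le_op_norm:
  assumes \<phi>: "analytic_selfmap \<phi>" and \<psi>: "analytic_selfmap \<psi>" and \<alpha>: "\<alpha> \<in> sphere 0 1" and K: "compact_op K"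
    and F: "F \<subseteq> sphere 0 1" "finite F" "F \<noteq> {}"
    and pos: "\<And>\<zeta>. \<zeta> \<in> F \<Longrightarrow> 0 < measure (clark_measure \<phi> \<alpha>) {\<zeta>}"
    and neq: "\<And>\<zeta>. \<zeta> \<in> F \<Longrightarrow> measure (clark_measure \<phi> \<alpha>) {\<zeta>} \<noteq> measure (clark_measure \<psi> \<alpha>) {\<zeta>}"
  shows "sqrt (\<Sum>\<zeta>\<in>F. measure (clark_measure \<phi> \<alpha>) {\<zeta>}) \<le> op_norm (\<lambda>f z. comp_op \<phi> f z - comp_op \<psi> f z - K f z)"
proof -
  define a where "a \<zeta> = measure (clark_measure \<phi> \<alpha>) {\<zeta>}" for \<zeta>
  define b where "b \<zeta> = measure (clark_measure \<psi> \<alpha>) {\<zeta>}" for \<zeta>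
  define A where "A = (\<Sum>\<zeta>\<in>F. a \<zeta>)"
  have a: "0 < a \<zeta>" if "\<zeta> \<in> F" for \<zeta>
    using pos that by (simp add: a_def)
  have A: "0 < A"
    unfolding A_def using F a by (intro sum_pos) auto
  have aA: "a \<zeta> \<le> A" if "\<zeta> \<in> F" for \<zeta>
    unfolding A_def using that F(2) a less_imp_le by (intro member_le_sum) auto
  define c where "c \<zeta> = sqrt (a \<zeta> / A)" for \<zeta>
  have c1: "(\<Sum>\<zeta>\<in>F. (c \<zeta>)\<^sup>2) = 1"
  proof -
    have "(\<Sum>\<zeta>\<in>F. (c \<zeta>)\<^sup>2) = (\<Sum>\<zeta>\<in>F. a \<zeta> / A)"
      using a A by (intro sum.cong) (auto simp: c_def less_imp_le)
    also have "\<dots> = 1"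
      using A by (simp add: sum_divide_distrib[symmetric] A_def)
    finally show ?thesis .
  qed
  define L where "L M = (\<Sum>\<zeta>\<in>F. complex_of_real (c \<zeta>) * (of_real (sqrt (a \<zeta>)) -
      of_real (2 * sqrt (a \<zeta>) * b \<zeta>) / (of_real (a \<zeta>) * Complex 1 M + of_real (b \<zeta>) * cnj (Complex 1 M))))" for M
  have le: "cmod (L M) \<le> op_norm (\<lambda>f z. comp_op \<phi> f z - comp_op \<psi> f z - K f z)" for M
  proof -
    define s where "s = Complex 1 M"
    have s: "Re s = 1"
      by (simp add: s_def)
    have s0: "0 < (cmod s)\<^sup>2"
      using s by auto
    \<comment> \<open>The factor \<open>1 + A\<close> dominates both 1 and every mass
      \<open>a \<zeta>\<close>, so one sequence meets the smallness conditions at w and at all atoms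
      simultaneously.\<close>
    define \<epsilon> where "\<epsilon> n = 1 / ((1 + A) * (cmod s)\<^sup>2) * (1 / real (Suc n))" for n
    have \<epsilon>0: "0 < \<epsilon> n" for n
      unfolding \<epsilon>_def using A s0 by (intro mult_pos_pos divide_pos_pos) auto
    have "\<epsilon> \<longlonglongrightarrow> 1 / ((1 + A) * (cmod s)\<^sup>2) * 0"
      unfolding \<epsilon>_def by (intro tendsto_intros LIMSEQ_inverse_real_of_nat[unfolded inverse_eq_divide])
    then have \<epsilon>lim: "\<epsilon> \<longlonglongrightarrow> 0"
      by simp
    have \<epsilon>A: "\<epsilon> n * ((1 + A) * (cmod s)\<^sup>2) \<le> 1" for n
    proof -
      have "\<epsilon> n * ((1 + A) * (cmod s)\<^sup>2) = 1 / real (Suc n)"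
        using A s0 by (simp add: \<epsilon>_def)
      then show ?thesis
        by simp
    qed
    have \<epsilon>1: "\<epsilon> n * (x * (cmod s)\<^sup>2) \<le> 1" if "x \<le> 1 + A" for n x
    proof -
      have "\<epsilon> n * (x * (cmod s)\<^sup>2) \<le> \<epsilon> n * ((1 + A) * (cmod s)\<^sup>2)"
        using that \<epsilon>0[of n] by (intro mult_left_mono mult_right_mono) auto
      then show ?thesis
        using \<epsilon>A[of n] by linarith
    qed
    have \<epsilon>s: "\<epsilon> n * (cmod s)\<^sup>2 \<le> 1" for n
      using \<epsilon>1[of 1 n] A by simp
    have \<epsilon>a: "\<epsilon> n * (a \<zeta> * (cmod s)\<^sup>2) \<le> 1" if "\<zeta> \<in> F" for \<zeta> n
      using \<epsilon>1[of "a \<zeta>" n] aA[OF that] by simp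
    define z where "z \<zeta> n = \<zeta> * (1 - of_real (\<epsilon> n) * (of_real (a \<zeta>) * s))" for \<zeta> n
    define w where "w n = \<alpha> * (1 - of_real (\<epsilon> n) * s)" for n
    have wb: "w n \<in> ball 0 1" for n
      unfolding w_def using nontangential_approach(2)[of \<alpha> "\<epsilon> n" s] \<alpha> \<epsilon>0 \<epsilon>s s by simp
    have zb: "z \<zeta> n \<in> ball 0 1" if "\<zeta> \<in> F" for \<zeta> n
    proof -
      have "(cmod (of_real (a \<zeta>) * s))\<^sup>2 = a \<zeta> * (a \<zeta> * (cmod s)\<^sup>2)"
        using a[OF that] by (simp add: norm_mult power_mult_distrib power2_eq_square)
      then have "\<epsilon> n * (cmod (of_real (a \<zeta>) * s))\<^sup>2 \<le> Re (of_real (a \<zeta>) * s)"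
        using mult_left_mono[OF \<epsilon>a[OF that, of n], of "a \<zeta>"] a[OF that] s by (simp add: mult_ac)
      then show ?thesis
        unfolding z_def using that F(1) a[OF that] s \<epsilon>0 by (intro nontangential_approach(2)) auto
    qed
    have zl: "z \<zeta> \<longlonglongrightarrow> \<zeta>" for \<zeta>
      unfolding z_def by (rule approach_tendsto[OF \<epsilon>lim])
    have pair: "(\<lambda>n. of_real (sqrt (1 - (cmod (z \<zeta> n))\<^sup>2)) * h2_kernel (w n) (\<theta> (z \<zeta> n)))
        \<longlonglongrightarrow> of_real (2 * sqrt (a \<zeta>) * measure (clark_measure \<theta> \<alpha>) {\<zeta>}) /
          (of_real (a \<zeta>) * s + of_real (measure (clark_measure \<theta> \<alpha>) {\<zeta>}) * cnj s)"
      if "\<zeta> \<in> F" "analytic_selfmap \<theta>" for \<zeta> \<theta>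
      unfolding z_def w_def using that F(1) a \<epsilon>0 \<epsilon>s \<epsilon>a \<epsilon>lim s \<alpha>
      by (intro kernel_pairing_limit) auto
    \<comment> \<open>For \<phi> the two masses in the pairing limit coincide and the imaginary
      parts of the denominator cancel, so the contribution is independent of M.\<close>
    have "of_real (2 * sqrt (a \<zeta>) * a \<zeta>) / (of_real (a \<zeta>) * s + of_real (a \<zeta>) * cnj s) = complex_of_real (sqrt (a \<zeta>))"
      if "\<zeta> \<in> F" for \<zeta>
    proof -
      have "of_real (a \<zeta>) * s + of_real (a \<zeta>) * cnj s = complex_of_real (2 * a \<zeta>)"
        by (simp add: complex_eq_iff s)
      then show ?thesis
        using a[OF that] by (simp del: of_real_mult add: of_real_divide[symmetric])
    qed
    then have "(\<lambda>n. \<Sum>\<zeta>\<in>F. complex_of_real (c \<zeta>) * (of_real (sqrt (1 - (cmod (z \<zeta> n))\<^sup>2)) * h2_kernel (w n) (\<phi> (z \<zeta> n)) -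
        of_real (sqrt (1 - (cmod (z \<zeta> n))\<^sup>2)) * h2_kernel (w n) (\<psi> (z \<zeta> n)))) \<longlonglongrightarrow> L M"
      unfolding L_def s_def[symmetric]
      using pair[OF _ \<phi>] pair[OF _ \<psi>] unfolding a_def[symmetric] b_def[symmetric]
      by (intro tendsto_sum tendsto_mult tendsto_diff tendsto_const) auto
    then have "(\<lambda>n. \<Sum>\<zeta>\<in>F. complex_of_real (c \<zeta> * sqrt (1 - (cmod (z \<zeta> n))\<^sup>2)) *
        (h2_kernel (w n) (\<phi> (z \<zeta> n)) - h2_kernel (w n) (\<psi> (z \<zeta> n)))) \<longlonglongrightarrow> L M"
      by (simp add: algebra_simps)
    then show ?thesis
      by (intro pairing_le_op_norm[OF \<phi> \<psi> K h2_kernel_H2[OF wb] F(1,2) zb zl c1])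
  qed
  have "(\<lambda>k. L (real k)) \<longlonglongrightarrow> (\<Sum>\<zeta>\<in>F. complex_of_real (c \<zeta>) * (of_real (sqrt (a \<zeta>)) - 0))"
    unfolding L_def
  proof (intro tendsto_intros)
    fix \<zeta> assume \<zeta>: "\<zeta> \<in> F"
    \<comment> \<open>The imaginary part of the denominator is k times the difference of the masses,
      so unequal masses make its modulus grow at least linearly in k; \<open>C\<close> collects the
      remaining constants.\<close>
    define C where "C = 2 * sqrt (a \<zeta>) * b \<zeta> / \<bar>a \<zeta> - b \<zeta>\<bar>"
    have ab: "\<bar>a \<zeta> - b \<zeta>\<bar> > 0"
      using neq[OF \<zeta>] by (simp add: a_def b_def)
    have b0: "0 \<le> b \<zeta>"
      by (simp add: b_def)
    have "norm (complex_of_real (2 * sqrt (a \<zeta>) * b \<zeta>) /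
        (of_real (a \<zeta>) * Complex 1 (real k) + of_real (b \<zeta>) * cnj (Complex 1 (real k)))) \<le> C * (1 / real k)" if "k > 0" for k
    proof -
      let ?q = "of_real (a \<zeta>) * Complex 1 (real k) + of_real (b \<zeta>) * cnj (Complex 1 (real k))"
      have "real k * \<bar>a \<zeta> - b \<zeta>\<bar> = \<bar>real k * (a \<zeta> - b \<zeta>)\<bar>"
        by (simp add: abs_mult)
      also have "\<dots> = \<bar>Im ?q\<bar>"
        by (simp add: algebra_simps)
      also have "\<dots> \<le> cmod ?q"
        by (rule abs_Im_le_cmod)
      finally have q: "real k * \<bar>a \<zeta> - b \<zeta>\<bar> \<le> cmod ?q" .
      have "0 < real k * \<bar>a \<zeta> - b \<zeta>\<bar>"
        using ab that by simp
      then have qp: "0 < cmod ?q"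
        using q by linarith
      have "norm (complex_of_real (2 * sqrt (a \<zeta>) * b \<zeta>) / ?q) = 2 * sqrt (a \<zeta>) * b \<zeta> / cmod ?q"
        using a[OF \<zeta>] b0 by (simp add: norm_divide norm_mult)
      also have "\<dots> \<le> 2 * sqrt (a \<zeta>) * b \<zeta> / (real k * \<bar>a \<zeta> - b \<zeta>\<bar>)"
        using q qp ab that a[OF \<zeta>] b0 by (intro divide_left_mono mult_pos_pos) auto
      also have "\<dots> = C * (1 / real k)"
        by (simp add: C_def)
      finally show ?thesis .
    qed
    then have "\<forall>\<^sub>F k in sequentially. norm (complex_of_real (2 * sqrt (a \<zeta>) * b \<zeta>) /
        (of_real (a \<zeta>) * Complex 1 (real k) + of_real (b \<zeta>) * cnj (Complex 1 (real k)))) \<le> C * (1 / real k)"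
      by (rule eventually_mono[OF eventually_gt_at_top[of 0]])
    moreover have "(\<lambda>k. C * (1 / real k)) \<longlonglongrightarrow> 0"
      by (intro tendsto_mult_right_zero lim_1_over_n)
    ultimately show "(\<lambda>k. complex_of_real (2 * sqrt (a \<zeta>) * b \<zeta>) /
        (of_real (a \<zeta>) * Complex 1 (real k) + of_real (b \<zeta>) * cnj (Complex 1 (real k)))) \<longlonglongrightarrow> 0"
      by (rule Lim_null_comparison)
  qed
  moreover have "(\<Sum>\<zeta>\<in>F. complex_of_real (c \<zeta>) * (of_real (sqrt (a \<zeta>)) - 0)) = of_real (sqrt A)"
  proof -
    have "c \<zeta> * sqrt (a \<zeta>) = a \<zeta> / sqrt A" if "\<zeta> \<in> F" for \<zeta>
      using a[OF that] by (simp add: c_def real_sqrt_divide)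
    then have "(\<Sum>\<zeta>\<in>F. c \<zeta> * sqrt (a \<zeta>)) = A / sqrt A"
      by (simp add: A_def sum_divide_distrib)
    also have "\<dots> = sqrt A"
      using A by (simp add: real_div_sqrt)
    finally have "complex_of_real (\<Sum>\<zeta>\<in>F. c \<zeta> * sqrt (a \<zeta>)) = of_real (sqrt A)"
      by (simp only:)
    then show ?thesis
      by simp
  qed
  ultimately have "(\<lambda>k. L (real k)) \<longlonglongrightarrow> of_real (sqrt A)"
    by simp
  from tendsto_norm[OF this] have "(\<lambda>k. cmod (L (real k))) \<longlonglongrightarrow> sqrt A"
    using A by simp
  then have "sqrt A \<le> op_norm (\<lambda>f z. comp_op \<phi> f z - comp_op \<psi> f z - K f z)"
    by (rule LIMSEQ_le_const2) (use le in auto)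
  then show ?thesis
    by (simp add: A_def a_def)
qed

theorem theorem3p2:
  fixes \<phi> \<psi> :: "complex \<Rightarrow> complex" and \<alpha> :: complex
  assumes "analytic_selfmap \<phi>" and "analytic_selfmap \<psi>" and "\<alpha> \<in> sphere 0 1"
  defines "Z \<equiv> {\<zeta> \<in> sphere 0 1.
      0 < measure (clark_measure \<phi> \<alpha>) {\<zeta>} \<and>
      measure (clark_measure \<phi> \<alpha>) {\<zeta>} \<noteq> measure (clark_measure \<psi> \<alpha>) {\<zeta>}}"
  shows "(ess_norm (\<lambda>f z. comp_op \<phi> f z - comp_op \<psi> f z))\<^sup>2 \<ge> measure (clark_measure \<phi> \<alpha>) Z"
proof -
  define \<mu> where "\<mu> = clark_measure \<phi> \<alpha>"
  define E where "E = ess_norm (\<lambda>f z. comp_op \<phi> f z - comp_op \<psi> f z)"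
  have \<mu>: "circle_measure \<mu>"
    unfolding \<mu>_def by (rule clark_measure_properties(1)[OF assms(1,3)])
  interpret finite_measure \<mu>
    using \<mu> by (simp add: circle_measure_def)
  have sing: "{\<zeta>} \<in> sets \<mu>" if "\<zeta> \<in> sphere 0 1" for \<zeta>
  proof -
    have "{\<zeta>} = sphere 0 1 \<inter> {\<zeta>}"
      using that by auto
    then show ?thesis
      using \<mu> by (auto simp: circle_measure_def sets_restrict_space)
  qed
  have fin: "measure \<mu> F \<le> E\<^sup>2" if F: "finite F" "F \<subseteq> Z" for F
  proof (cases "F = {}")
    case False
    have sub: "F \<subseteq> sphere 0 1"
      using F by (auto simp: Z_def)
    have "sqrt (\<Sum>\<zeta>\<in>F. measure \<mu> {\<zeta>}) \<le> E"
      unfolding E_def ess_norm_def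
    proof (rule cINF_greatest)
      show "{C. compact_op C} \<noteq> {}"
        using compact_op_zero by blast
      fix K assume "K \<in> {C. compact_op C}"
      then show "sqrt (\<Sum>\<zeta>\<in>F. measure \<mu> {\<zeta>}) \<le> op_norm (\<lambda>f z. comp_op \<phi> f z - comp_op \<psi> f z - K f z)"
        unfolding \<mu>_def using F sub False
        by (intro finite_atoms_le_op_norm[OF assms(1-3)]) (auto simp: Z_def)
    qed
    moreover have "measure \<mu> F = (\<Sum>\<zeta>\<in>F. measure \<mu> {\<zeta>})"
      using sub sing by (intro finite_measure_eq_sum_singleton F) auto
    ultimately show ?thesis
      by (simp add: sqrt_le_D)
  qed simp
  \<comment> \<open>A finite measure has countably many atoms, so the estimate for finite sets of
    atoms reaches Z by exhaustion.\<close>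
  have "countable {\<zeta>. measure \<mu> {\<zeta>} \<noteq> 0}"
    by (rule countable_support)
  then have cZ: "countable Z"
    by (rule countable_subset[rotated]) (auto simp: Z_def \<mu>_def)
  show ?thesis
  proof (cases "Z = {}")
    case True
    then show ?thesis
      by simp
  next
    case False
    \<comment> \<open>An increasing sequence of finite sets; \<open>from_nat_into Z\<close> is sure
      to take its values in Z only for nonempty Z, which explains the case split.\<close>
    define S where "S n = from_nat_into Z ` {..n}" for n
    have S: "finite (S n)" "S n \<subseteq> Z" for n
      using from_nat_into[OF False] by (auto simp: S_def)
    have "S n \<in> sets \<mu>" for n
    proof -
      have "(\<Union>\<zeta>\<in>S n. {\<zeta>}) \<in> sets \<mu>"
        using S[of n] sing by (intro sets.finite_UN) (auto simp: Z_def)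
      then show ?thesis
        by simp
    qed
    then have "(\<lambda>n. measure \<mu> (S n)) \<longlonglongrightarrow> measure \<mu> (\<Union>n. S n)"
      by (intro finite_Lim_measure_incseq) (auto simp: incseq_def S_def)
    moreover have "(\<Union>n. S n) = Z"
    proof -
      have "(\<Union>n. S n) = range (from_nat_into Z)"
        by (auto simp: S_def)
      then show ?thesis
        using range_from_nat_into[OF False cZ] by simp
    qed
    ultimately have "measure \<mu> Z \<le> E\<^sup>2"
      using fin[OF S] by (intro LIMSEQ_le_const2[of "\<lambda>n. measure \<mu> (S n)"]) auto
    then show ?thesis
      by (simp add: \<mu>_def E_def)
  qed
qed

end
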